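(* Let $a>0$ and let $\mathfrak{h}_3$ be the three-dimensional real Heisenberg Lie algebra, with basis $\mathcal{B}=\{\beta_1,\beta_2,\beta_3\}$ and pre-Lie structure defined by $\beta_1\cdot\beta_2=a\beta_3$ (all other products of basis elements being zero), so that the only nonzero bracket of basis elements is $[\beta_1,\beta_2]=a\beta_3$ up to antisymmetry. Let $\mathrm{H}_3(\mathbb{R})$ be the corresponding connected, simply connected, contractible Lie group, diffeomorphic to $\mathbb{R}^3$. Then the cohomology of the Lie algebra $\mathfrak{h}_3$ of left-invariant forms is $$\mathrm{H}^0(\mathfrak{h}_3,\mathbb{R})\cong\mathbb{R},\quad \mathrm{H}^1(\mathfrak{h}_3,\mathbb{R})\cong\mathbb{R}^2,\quad \mathrm{H}^2(\mathfrak{h}_3,\mathbb{R})\cong\mathbb{R}^2,\quad \mathrm{H}^3(\mathfrak{h}_3,\mathbb{R})\cong\mathbb{R}.$$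
   Context: Concretely $\beta_i=ae_i$ where $e_1=E_{12}$, $e_2=E_{23}$, $e_3=E_{13}$ are elementary strictly upper triangular $3\times3$ matrices. $\mathrm{H}^k(\mathfrak{g},\mathbb{R})$ denotes the cohomology of the complex of left-invariant differential forms on the Lie group (equivalently of alternating forms on $\mathfrak{g}$) with the exterior differential, so that $\mathrm{d}\omega(X,Y)=-\omega([X,Y])$ for a left-invariant one-form $\omega$ and $X,Y\in\mathfrak{g}$. *)

theory Defs
  imports "HOL-Analysis.Analysis"
begin

section \<open>Cochain complexes of real-valued functions and their cohomology\<close>

text \<open>A cochain complex is given by the sets \<open>C k\<close> of \<open>k\<close>-cochains, which are real-valued functions
  with the pointwise vector space structure, and the differentials \<open>d k\<close> from \<open>C k\<close> to \<open>C (k + 1)\<close>.\<close>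

definition cocycles ::
    "(nat \<Rightarrow> ('c \<Rightarrow> real) set) \<Rightarrow> (nat \<Rightarrow> ('c \<Rightarrow> real) \<Rightarrow> 'c \<Rightarrow> real) \<Rightarrow> nat \<Rightarrow> ('c \<Rightarrow> real) set" where
  "cocycles C d k = {\<omega> \<in> C k. d k \<omega> = (\<lambda>_. 0)}"

definition coboundaries ::
    "(nat \<Rightarrow> ('c \<Rightarrow> real) set) \<Rightarrow> (nat \<Rightarrow> ('c \<Rightarrow> real) \<Rightarrow> 'c \<Rightarrow> real) \<Rightarrow> nat \<Rightarrow> ('c \<Rightarrow> real) set" where
  "coboundaries C d k = (case k of 0 \<Rightarrow> {\<lambda>_. 0} | Suc l \<Rightarrow> d l ` C l)"

definition cohomology_class ::
    "(nat \<Rightarrow> ('c \<Rightarrow> real) set) \<Rightarrow> (nat \<Rightarrow> ('c \<Rightarrow> real) \<Rightarrow> 'c \<Rightarrow> real) \<Rightarrow> nat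
      \<Rightarrow> ('c \<Rightarrow> real) \<Rightarrow> ('c \<Rightarrow> real) set" where
  "cohomology_class C d k \<omega> = {(\<lambda>x. \<omega> x + \<eta> x) | \<eta>. \<eta> \<in> coboundaries C d k}"

definition cohomology ::
    "(nat \<Rightarrow> ('c \<Rightarrow> real) set) \<Rightarrow> (nat \<Rightarrow> ('c \<Rightarrow> real) \<Rightarrow> 'c \<Rightarrow> real) \<Rightarrow> nat \<Rightarrow> ('c \<Rightarrow> real) set set" where
  "cohomology C d k = cohomology_class C d k ` cocycles C d k"

text \<open>The vector space operations of the quotient are \<open>[\<omega>] + [\<eta>] = [\<omega> + \<eta>]\<close> and \<open>c [\<omega>] = [c \<omega>]\<close>.\<close>

definition cohomology_iso ::
    "(nat \<Rightarrow> ('c \<Rightarrow> real) set) \<Rightarrow> (nat \<Rightarrow> ('c \<Rightarrow> real) \<Rightarrow> 'c \<Rightarrow> real) \<Rightarrow> nat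
      \<Rightarrow> (('c \<Rightarrow> real) set \<Rightarrow> 'e::real_vector) \<Rightarrow> bool" where
  "cohomology_iso C d k \<phi> \<longleftrightarrow>
     bij_betw \<phi> (cohomology C d k) UNIV \<and>
     (\<forall>\<omega> \<in> cocycles C d k. \<forall>\<eta> \<in> cocycles C d k.
        \<phi> (cohomology_class C d k (\<lambda>x. \<omega> x + \<eta> x))
          = \<phi> (cohomology_class C d k \<omega>) + \<phi> (cohomology_class C d k \<eta>)) \<and>
     (\<forall>c. \<forall>\<omega> \<in> cocycles C d k.
        \<phi> (cohomology_class C d k (\<lambda>x. c * \<omega> x)) = c *\<^sub>R \<phi> (cohomology_class C d k \<omega>))"


section \<open>Alternating forms on a Lie algebra\<close>

text \<open>\<open>V\<close> is a linear subspace of the type. A \<open>k\<close>-form on \<open>V\<close> is a function of the lists of length \<open>k\<close>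
  with entries in \<open>V\<close>, extended by zero to all other lists so that equality of forms is equality of
  functions.\<close>

definition tuples :: "'v set \<Rightarrow> nat \<Rightarrow> 'v list set" where
  "tuples V k = {xs. length xs = k \<and> set xs \<subseteq> V}"

definition alt_forms :: "'v::real_vector set \<Rightarrow> nat \<Rightarrow> ('v list \<Rightarrow> real) set" where
  "alt_forms V k = {\<omega>.
     (\<forall>xs. xs \<notin> tuples V k \<longrightarrow> \<omega> xs = 0) \<and>
     (\<forall>xs \<in> tuples V k. \<forall>i < k. \<forall>x \<in> V. \<forall>y \<in> V.
        \<omega> (xs[i := x + y]) = \<omega> (xs[i := x]) + \<omega> (xs[i := y])) \<and>
     (\<forall>xs \<in> tuples V k. \<forall>i < k. \<forall>c. \<forall>x \<in> V. \<omega> (xs[i := c *\<^sub>R x]) = c * \<omega> (xs[i := x])) \<and>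
     (\<forall>xs \<in> tuples V k. \<forall>i < k. \<forall>j < k. i \<noteq> j \<and> xs ! i = xs ! j \<longrightarrow> \<omega> xs = 0)}"

text \<open>The differential on alternating forms:
  \<open>d\<omega>(x\<^sub>0,\<dots>,x\<^sub>k) = \<Sum>\<^bsub>i<j\<^esub> (-1)\<^bsup>i+j\<^esup> \<omega>([x\<^sub>i,x\<^sub>j], \<dots>)\<close> with \<open>x\<^sub>i\<close> and \<open>x\<^sub>j\<close> omitted from the remaining arguments.\<close>

definition lie_diff ::
    "'v::real_vector set \<Rightarrow> ('v \<Rightarrow> 'v \<Rightarrow> 'v) \<Rightarrow> nat \<Rightarrow> ('v list \<Rightarrow> real) \<Rightarrow> 'v list \<Rightarrow> real" where
  "lie_diff V br k \<omega> xs =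
     (if xs \<in> tuples V (Suc k)
      then \<Sum>j\<le>k. \<Sum>i<j. (-1) ^ (i + j) * \<omega> (br (xs ! i) (xs ! j) # nths xs (- {i, j}))
      else 0)"

lemma lie_diff_one_form:
  assumes "x \<in> V" "y \<in> V"
  shows "lie_diff V br 1 \<omega> [x, y] = - \<omega> [br x y]"
  using assms by (simp add: lie_diff_def tuples_def nths_Cons)


section \<open>Left-invariant differential forms on a matrix group\<close>

text \<open>Here \<open>G\<close> is a group of matrices that is an affine subspace of the space of all matrices, with
  direction \<open>V\<close>. Hence every tangent space of \<open>G\<close> is \<open>V\<close>, the curves \<open>t \<mapsto> g + t v\<close> with \<open>v \<in> V\<close> stay
  in \<open>G\<close>, and linear coordinates on \<open>V\<close> give a global chart of \<open>G\<close>.\<close>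

definition dir_deriv :: "('v::real_vector \<Rightarrow> real) \<Rightarrow> 'v \<Rightarrow> 'v \<Rightarrow> real" where
  "dir_deriv f v g = deriv (\<lambda>t. f (g + t *\<^sub>R v)) 0"

primrec Ck_on :: "nat \<Rightarrow> 'v::real_normed_vector set \<Rightarrow> 'v set \<Rightarrow> ('v \<Rightarrow> real) \<Rightarrow> bool" where
  "Ck_on 0 G V f \<longleftrightarrow> continuous_on G f"
| "Ck_on (Suc n) G V f \<longleftrightarrow>
     continuous_on G f \<and>
     (\<forall>v \<in> V. (\<forall>g \<in> G. (\<lambda>t. f (g + t *\<^sub>R v)) field_differentiable (at 0)) \<and>
              Ck_on n G V (dir_deriv f v))"

definition smooth_fun_on :: "'v::real_normed_vector set \<Rightarrow> 'v set \<Rightarrow> ('v \<Rightarrow> real) \<Rightarrow> bool" where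
  "smooth_fun_on G V f \<longleftrightarrow> (\<forall>n. Ck_on n G V f)"

text \<open>\<open>\<omega> (g, xs)\<close> is the value of the form \<open>\<omega>\<close> at the point \<open>g\<close> on the tangent vectors \<open>xs\<close>.\<close>

definition diff_forms ::
    "'v::real_normed_vector set \<Rightarrow> 'v set \<Rightarrow> nat \<Rightarrow> ('v \<times> 'v list \<Rightarrow> real) set" where
  "diff_forms G V k = {\<omega>.
     (\<forall>g \<in> G. (\<lambda>xs. \<omega> (g, xs)) \<in> alt_forms V k) \<and>
     (\<forall>g xs. g \<notin> G \<longrightarrow> \<omega> (g, xs) = 0) \<and>
     (\<forall>xs \<in> tuples V k. smooth_fun_on G V (\<lambda>g. \<omega> (g, xs)))}"

text \<open>The exterior derivative; the invariant formula is evaluated on constant vector fields, whose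
  brackets vanish.\<close>

definition ext_deriv ::
    "'v::real_normed_vector set \<Rightarrow> 'v set \<Rightarrow> nat \<Rightarrow> ('v \<times> 'v list \<Rightarrow> real) \<Rightarrow> 'v \<times> 'v list \<Rightarrow> real" where
  "ext_deriv G V k \<omega> = (\<lambda>(g, xs).
     if g \<in> G \<and> xs \<in> tuples V (Suc k)
     then \<Sum>i\<le>k. (-1) ^ i * dir_deriv (\<lambda>h. \<omega> (h, nths xs (- {i}))) (xs ! i) g
     else 0)"

text \<open>Left translation by \<open>h\<close> is the restriction of the linear map \<open>(**) h\<close>, which is therefore also
  its derivative.\<close>

definition left_invariant_forms ::
    "(real^'n^'n) set \<Rightarrow> (real^'n^'n) set \<Rightarrow> nat \<Rightarrow> ((real^'n^'n) \<times> (real^'n^'n) list \<Rightarrow> real) set" where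
  "left_invariant_forms G V k = {\<omega> \<in> diff_forms G V k.
     \<forall>h \<in> G. \<forall>g \<in> G. \<forall>xs \<in> tuples V k. \<omega> (h ** g, map ((**) h) xs) = \<omega> (g, xs)}"


section \<open>The Heisenberg Lie algebra and the Heisenberg group\<close>

definition elem_mat :: "'n \<Rightarrow> 'n \<Rightarrow> real^'n^'n" where
  "elem_mat i j = (\<chi> r c. if r = i \<and> c = j then 1 else 0)"

definition heis_basis :: "real \<Rightarrow> 3 \<Rightarrow> real^3^3" where
  "heis_basis a i =
     a *\<^sub>R (if i = 1 then elem_mat 1 2 else if i = 2 then elem_mat 2 3 else elem_mat 1 3)"

definition heis_algebra :: "real \<Rightarrow> (real^3^3) set" where
  "heis_algebra a = span (range (heis_basis a))"

definition heis_group :: "real \<Rightarrow> (real^3^3) set" where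
  "heis_group a = {mat 1 + X | X. X \<in> heis_algebra a}"

definition bilinear_on :: "'v::real_vector set \<Rightarrow> ('v \<Rightarrow> 'v \<Rightarrow> 'v) \<Rightarrow> bool" where
  "bilinear_on V f \<longleftrightarrow>
     (\<forall>x \<in> V. \<forall>y \<in> V. \<forall>z \<in> V. f (x + y) z = f x z + f y z \<and> f z (x + y) = f z x + f z y) \<and>
     (\<forall>c. \<forall>x \<in> V. \<forall>y \<in> V. f (c *\<^sub>R x) y = c *\<^sub>R f x y \<and> f x (c *\<^sub>R y) = c *\<^sub>R f x y)"

text \<open>On the algebra, bilinearity and the table of products of basis elements determine the product
  completely; by \<open>heis_prelie_matrix_mult\<close> and \<open>heis_prelie_unique\<close> below it is the matrix product.\<close>

definition heis_prelie :: "real \<Rightarrow> (real^3^3 \<Rightarrow> real^3^3 \<Rightarrow> real^3^3) \<Rightarrow> bool" where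
  "heis_prelie a p \<longleftrightarrow>
     bilinear_on (heis_algebra a) p \<and>
     p (heis_basis a 1) (heis_basis a 2) = a *\<^sub>R heis_basis a 3 \<and>
     (\<forall>i j. (i, j) \<noteq> (1, 2) \<longrightarrow> p (heis_basis a i) (heis_basis a j) = 0)"

definition commutator :: "('v \<Rightarrow> 'v \<Rightarrow> 'v::real_vector) \<Rightarrow> 'v \<Rightarrow> 'v \<Rightarrow> 'v" where
  "commutator p x y = p x y - p y x"

lemma heis_basis_inj: "a \<noteq> 0 \<Longrightarrow> inj (heis_basis a)"
  unfolding inj_def forall_3
  by (auto simp: heis_basis_def elem_mat_def vec_eq_iff forall_3)

lemma heis_basis_sum:
  "(\<Sum>i\<in>UNIV. u i *\<^sub>R heis_basis a i) =
     vector [vector [0, u 1 * a, u 3 * a], vector [0, 0, u 2 * a], vector [0, 0, 0]]"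
  by (simp add: vec_eq_iff forall_3 sum_3 heis_basis_def elem_mat_def)

lemma heis_basis_independent:
  assumes "a \<noteq> 0"
  shows "independent (range (heis_basis a))"
proof -
  have "\<forall>i. u (heis_basis a i) = 0" if "(\<Sum>v\<in>range (heis_basis a). u v *\<^sub>R v) = 0" for u
  proof -
    have "(\<Sum>i\<in>UNIV. u (heis_basis a i) *\<^sub>R heis_basis a i) = 0"
      using that heis_basis_inj[OF assms] by (simp add: sum.reindex)
    then show ?thesis
      unfolding heis_basis_sum using assms
      by (simp add: vec_eq_iff forall_3)
  qed
  then show ?thesis
    by (subst dependent_finite) auto
qed

lemma heis_algebra_dim: "a \<noteq> 0 \<Longrightarrow> dim (heis_algebra a) = 3"
  by (simp add: heis_algebra_def dim_eq_card_independent heis_basis_independent card_image heis_basis_inj)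

lemma heis_algebra_iff:
  assumes "a \<noteq> 0"
  shows "X \<in> heis_algebra a \<longleftrightarrow> (\<forall>r c. r = 3 \<or> c = 1 \<or> r = c \<longrightarrow> X $ r $ c = 0)"
proof
  assume "X \<in> heis_algebra a"
  then show "\<forall>r c. r = 3 \<or> c = 1 \<or> r = c \<longrightarrow> X $ r $ c = 0"
    unfolding heis_algebra_def
  proof (induction rule: span_induct_alt)
    case base
    then show ?case by simp
  next
    case (step c x y)
    then obtain i where "x = heis_basis a i" by auto
    with step show ?case
      by (auto simp: heis_basis_def elem_mat_def)
  qed
next
  assume X: "\<forall>r c. r = 3 \<or> c = 1 \<or> r = c \<longrightarrow> X $ r $ c = 0"
  define u where "u = (\<lambda>i::3. (if i = 1 then X $ 1 $ 2 else if i = 2 then X $ 2 $ 3 else X $ 1 $ 3) / a)"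
  have "X = (\<Sum>i\<in>UNIV. u i *\<^sub>R heis_basis a i)"
    unfolding heis_basis_sum using X assms
    by (simp add: vec_eq_iff forall_3 u_def)
  then show "X \<in> heis_algebra a"
    unfolding heis_algebra_def by (metis (no_types, lifting) rangeI span_base span_scale span_sum)
qed

lemma heis_prelie_matrix_mult: "heis_prelie a (**)"
proof -
  have "\<forall>i j. (i, j) \<noteq> (1, 2) \<longrightarrow> heis_basis a i ** heis_basis a j = 0"
    unfolding forall_3
    by (simp add: vec_eq_iff forall_3 matrix_matrix_mult_def sum_3 heis_basis_def elem_mat_def)
  moreover have "heis_basis a 1 ** heis_basis a 2 = a *\<^sub>R heis_basis a 3"
    by (simp add: vec_eq_iff forall_3 matrix_matrix_mult_def sum_3 heis_basis_def elem_mat_def)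
  moreover have "bilinear_on (heis_algebra a) (**)"
    by (simp add: bilinear_on_def vec_eq_iff matrix_matrix_mult_def sum_distrib_left algebra_simps sum.distrib)
  ultimately show ?thesis by (simp add: heis_prelie_def)
qed

lemma heis_prelie_unique:
  assumes p: "heis_prelie a p" and q: "heis_prelie a q"
    and X: "X \<in> heis_algebra a" and Y: "Y \<in> heis_algebra a"
  shows "p X Y = q X Y"
proof -
  have basis: "p (heis_basis a i) (heis_basis a j) = q (heis_basis a i) (heis_basis a j)" for i j
    using p q by (cases "(i, j) = (1, 2)") (auto simp: heis_prelie_def)
  have bp: "bilinear_on (heis_algebra a) p" and bq: "bilinear_on (heis_algebra a) q"
    using p q by (auto simp: heis_prelie_def)
  have mem: "heis_basis a i \<in> heis_algebra a" for i
    by (simp add: heis_algebra_def span_base)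
  have sub: "subspace (heis_algebra a)"
    by (simp add: heis_algebra_def)
  have zero: "p 0 Z = 0" "q 0 Z = 0" "p Z 0 = 0" "q Z 0 = 0" if "Z \<in> heis_algebra a" for Z
    using bp bq that subspace_0[OF sub] unfolding bilinear_on_def by (metis scaleR_zero_left)+
  have left: "p X (heis_basis a j) = q X (heis_basis a j)" for j
  proof -
    have "X \<in> heis_algebra a \<and> p X (heis_basis a j) = q X (heis_basis a j)"
      using X unfolding heis_algebra_def
    proof (induction rule: span_induct_alt)
      case base
      show ?case using zero[OF mem] by (simp add: span_zero heis_algebra_def)
    next
      case (step c x y)
      then obtain i where i: "x = heis_basis a i" by auto
      have y: "y \<in> heis_algebra a" using step by (simp add: heis_algebra_def)
      have cx: "c *\<^sub>R x \<in> heis_algebra a" using i mem sub by (simp add: subspace_scale)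
      have "p (c *\<^sub>R x + y) (heis_basis a j) = q (c *\<^sub>R x + y) (heis_basis a j)"
        using bp bq y cx mem step i basis unfolding bilinear_on_def by metis
      then show ?case
        using subspace_add[OF sub cx y] by (simp add: heis_algebra_def)
    qed
    then show ?thesis by blast
  qed
  have "Y \<in> heis_algebra a \<and> p X Y = q X Y"
    using Y unfolding heis_algebra_def
  proof (induction rule: span_induct_alt)
    case base
    show ?case using zero[OF X] by (simp add: span_zero heis_algebra_def)
  next
    case (step c x y)
    then obtain i where i: "x = heis_basis a i" by auto
    have y: "y \<in> heis_algebra a" using step by (simp add: heis_algebra_def)
    have cx: "c *\<^sub>R x \<in> heis_algebra a" using i mem sub by (simp add: subspace_scale)
    have "p X (c *\<^sub>R x + y) = q X (c *\<^sub>R x + y)"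
      using bp bq X y cx mem step i left unfolding bilinear_on_def by metis
    then show ?case
      using subspace_add[OF sub cx y] by (simp add: heis_algebra_def)
  qed
  then show ?thesis by blast
qed

lemma heis_group_iff:
  assumes "a \<noteq> 0"
  shows "g \<in> heis_group a \<longleftrightarrow>
    g $ 1 $ 1 = 1 \<and> g $ 2 $ 2 = 1 \<and> g $ 3 $ 3 = 1 \<and> g $ 2 $ 1 = 0 \<and> g $ 3 $ 1 = 0 \<and> g $ 3 $ 2 = 0"
proof -
  have "g \<in> heis_group a \<longleftrightarrow> g - mat 1 \<in> heis_algebra a"
    by (force simp: heis_group_def)
  then show ?thesis
    by (auto simp: heis_algebra_iff[OF assms] forall_3 mat_def)
qed

lemma heis_group_mult:
  assumes "a \<noteq> 0" "g \<in> heis_group a" "h \<in> heis_group a"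
  shows "g ** h \<in> heis_group a"
  using assms by (simp add: heis_group_iff matrix_matrix_mult_def sum_3)

lemma heis_group_inverse:
  assumes "a \<noteq> 0" "g \<in> heis_group a"
  shows "\<exists>h \<in> heis_group a. g ** h = mat 1 \<and> h ** g = mat 1"
proof
  define h :: "real^3^3" where
    "h = vector [vector [1, - g$1$2, g$1$2 * g$2$3 - g$1$3], vector [0, 1, - g$2$3], vector [0, 0, 1]]"
  show "h \<in> heis_group a"
    using assms by (simp add: heis_group_iff h_def)
  show "g ** h = mat 1 \<and> h ** g = mat 1"
    using assms
    by (simp add: heis_group_iff h_def vec_eq_iff forall_3 matrix_matrix_mult_def sum_3 mat_def)
qed

lemma heis_group_convex: "convex (heis_group a)"
proof -
  have "heis_group a = (+) (mat 1) ` heis_algebra a"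
    by (auto simp: heis_group_def)
  then show ?thesis
    by (simp add: heis_algebra_def convex_translation subspace_imp_convex)
qed

lemma heis_group_topology:
  "connected (heis_group a)" "simply_connected (heis_group a)" "contractible (heis_group a)"
  using heis_group_convex
  by (simp_all add: convex_connected convex_imp_simply_connected convex_imp_contractible)

lemma heis_group_homeomorphic:
  assumes "a \<noteq> 0"
  shows "heis_group a homeomorphic (UNIV :: (real^3) set)"
proof -
  have "heis_group a = (+) (mat 1) ` heis_algebra a"
    by (auto simp: heis_group_def)
  moreover have "heis_algebra a homeomorphic (UNIV :: (real^3) set)"
    using heis_algebra_dim[OF assms]
    by (intro homeomorphic_subspaces) (simp_all add: heis_algebra_def)
  ultimately show ?thesis
    by (metis homeomorphic_translation homeomorphic_sym homeomorphic_trans)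
qed

end

theory Submission
  imports Defs
begin

text \<open>
  Both complexes are the same finite-dimensional complex written in two ways. Let \<open>\<theta>\<^sub>1, \<theta>\<^sub>2, \<theta>\<^sub>3\<close> be
  the coframe of the Heisenberg algebra that reads off the matrix entries (1,2), (2,3) and (1,3). Its products \<open>1\<close>,
  \<open>\<theta>\<^sub>i\<close>, \<open>\<theta>\<^sub>i \<and> \<theta>\<^sub>j\<close>, \<open>\<theta>\<^sub>1 \<and> \<theta>\<^sub>2 \<and> \<theta>\<^sub>3\<close> are bases of the forms of degree 0 to 3, and the commutator of
  \<open>X\<close> and \<open>Y\<close> is \<open>(\<theta>\<^sub>1 \<and> \<theta>\<^sub>2)(X, Y)\<close> times the central vector dual to \<open>\<theta>\<^sub>3\<close>. So the structure equations are
  \<open>d\<theta>\<^sub>1 = d\<theta>\<^sub>2 = 0\<close> and \<open>d\<theta>\<^sub>3 = - \<theta>\<^sub>1 \<and> \<theta>\<^sub>2\<close>, and \<open>d\<close> vanishes in all degrees except 1: on 2-forms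
  because all terms of \<open>d(\<theta>\<^sub>i \<and> \<theta>\<^sub>j)\<close> contain a repeated factor, and on 3-forms because the dimension
  is 3.
  Hence \<open>H\<^sup>0\<close> and \<open>H\<^sup>3\<close> are lines, \<open>H\<^sup>1\<close> is spanned by \<open>\<theta>\<^sub>1, \<theta>\<^sub>2\<close>, and \<open>H\<^sup>2\<close> is spanned by
  \<open>\<theta>\<^sub>1 \<and> \<theta>\<^sub>3, \<theta>\<^sub>2 \<and> \<theta>\<^sub>3\<close>; this is \<open>cohomology_of_heisenberg_coordinates\<close>.

  On the group, a left-invariant form is determined by its value at the identity, and translating
  \<open>\<theta>\<^sub>1, \<theta>\<^sub>2, \<theta>\<^sub>3\<close> gives \<open>dx, dy, dz - x dy\<close>, where \<open>x, y, z\<close> are the entries of the group element.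
  The coefficients of all translated forms are affine in the single coordinate \<open>x\<close>, which makes them
  smooth (\<open>smooth_affine\<close>) and lets the exterior derivative be read off (\<open>heis_ext_deriv\<close>): it is given
  by the same structure equations, since \<open>d(dz - x dy) = - dx \<and> dy\<close>.

  For \<open>a \<noteq> 0\<close> the \<open>\<beta>\<^sub>i\<close> span all strictly upper triangular matrices, and the pre-Lie product is the
  matrix product (\<open>heis_prelie_unique\<close>). So the elementary matrices may replace the \<open>\<beta>\<^sub>i\<close> as basis,
  which gives the structure equations above for every \<open>a\<close>.
\<close>

section \<open>Cohomology in linear coordinates\<close>

text \<open>\<open>E\<close> identifies the cochains of degree \<open>k\<close> with a vector space of coordinates, \<open>Z\<close> is the subspace
  of the cocycles, and the coboundaries are the kernel of \<open>P\<close> on \<open>Z\<close>. The claim is the first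
  isomorphism theorem: \<open>P\<close> descends to the quotient. Cochains are added pointwise, so \<open>E\<close> is
  linear if each of its evaluations is.\<close>

lemma cohomology_iso_if_coordinates:
  fixes E :: "'b::real_vector \<Rightarrow> 'c \<Rightarrow> real" and P :: "'b \<Rightarrow> 'e::real_vector"
  assumes lin: "\<And>x. linear (\<lambda>c. E c x)"
    and inj: "\<And>c. E c = (\<lambda>_. 0) \<Longrightarrow> c = 0"
    and Z: "subspace Z" "cocycles C d k = E ` Z"
    and B: "coboundaries C d k = E ` {c \<in> Z. P c = 0}"
    and P: "linear P" "P ` Z = UNIV"
  shows "\<exists>\<phi> :: _ \<Rightarrow> 'e. cohomology_iso C d k \<phi>"
proof -
  let ?cls = "cohomology_class C d k"
  have E_add: "E (c + c') = (\<lambda>x. E c x + E c' x)" and E_scale: "E (r *\<^sub>R c) = (\<lambda>x. r * E c x)"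
    and E_diff: "E (c - c') = (\<lambda>x. E c x - E c' x)" for c c' r
    using linear_add[OF lin] linear_scale[OF lin] linear_diff[OF lin] by auto
  have E_eq: "c = c'" if "E c = E c'" for c c'
    using inj[of "c - c'"] that by (simp add: E_diff)
  have cls: "?cls (E c) = E ` {c' \<in> Z. P c' = P c}" if "c \<in> Z" for c
  proof -
    have "?cls (E c) = {E (c + b) | b. b \<in> Z \<and> P b = 0}"
      by (auto simp: cohomology_class_def B E_add)
    also have "\<dots> = E ` {c' \<in> Z. P c' = P c}"
    proof safe
      fix b assume "b \<in> Z" "P b = 0"
      then show "E (c + b) \<in> E ` {c' \<in> Z. P c' = P c}"
        using that Z(1) by (auto simp: linear_add[OF P(1)] subspace_add)
    next
      fix c' assume "c' \<in> Z" "P c' = P c"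
      then show "\<exists>b. E c' = E (c + b) \<and> b \<in> Z \<and> P b = 0"
        using that Z(1) by (intro exI[of _ "c' - c"]) (simp add: linear_diff[OF P(1)] subspace_diff)
    qed
    finally show ?thesis .
  qed
  \<comment> \<open>The choice of a representative is harmless, because \<open>P\<close> is constant on each class.\<close>
  define \<phi> where "\<phi> A = P (SOME c. c \<in> Z \<and> E c \<in> A)" for A
  have \<phi>: "\<phi> (?cls (E c)) = P c" if "c \<in> Z" for c
  proof -
    have "\<exists>c'. c' \<in> Z \<and> E c' \<in> ?cls (E c)"
      using that cls by blast
    then have "E (SOME c'. c' \<in> Z \<and> E c' \<in> ?cls (E c)) \<in> ?cls (E c)"
      by (metis (mono_tags, lifting) someI_ex)
    then show ?thesis
      unfolding \<phi>_def cls[OF that] using E_eq by force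
  qed
  have "bij_betw \<phi> (cohomology C d k) UNIV"
    unfolding bij_betw_def
  proof
    show "inj_on \<phi> (cohomology C d k)"
      by (auto simp: inj_on_def cohomology_def Z(2) \<phi>) (auto simp: cls)
    have "\<phi> ` cohomology C d k = P ` Z"
      by (simp add: cohomology_def Z(2) image_image \<phi> cong: image_cong)
    then show "\<phi> ` cohomology C d k = UNIV"
      using P(2) by simp
  qed
  moreover have "\<phi> (?cls (\<lambda>x. E c x + E c' x)) = \<phi> (?cls (E c)) + \<phi> (?cls (E c'))"
    if "c \<in> Z" "c' \<in> Z" for c c'
    using that Z(1) by (simp flip: E_add add: \<phi> subspace_add linear_add[OF P(1)])
  moreover have "\<phi> (?cls (\<lambda>x. r * E c x)) = r *\<^sub>R \<phi> (?cls (E c))" if "c \<in> Z" for r c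
    using that Z(1) by (simp flip: E_scale add: \<phi> subspace_scale linear_scale[OF P(1)])
  ultimately show ?thesis
    unfolding cohomology_iso_def Z(2) by blast
qed

text \<open>The linear algebra common to the two complexes. The coordinates of a 2-form belong to
  \<open>\<theta>\<^sub>1 \<and> \<theta>\<^sub>2\<close>, \<open>\<theta>\<^sub>1 \<and> \<theta>\<^sub>3\<close>, \<open>\<theta>\<^sub>2 \<and> \<theta>\<^sub>3\<close> in this order, so that the second equation for \<open>d\<close> says
  \<open>d\<theta>\<^sub>3 = - \<theta>\<^sub>1 \<and> \<theta>\<^sub>2\<close>. The closed 1-forms are those without \<open>\<theta>\<^sub>3\<close>, and the exact 2-forms are the
  multiples of \<open>\<theta>\<^sub>1 \<and> \<theta>\<^sub>2\<close>.\<close>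

lemma cohomology_of_heisenberg_coordinates:
  fixes C :: "nat \<Rightarrow> ('c \<Rightarrow> real) set" and d :: "nat \<Rightarrow> ('c \<Rightarrow> real) \<Rightarrow> 'c \<Rightarrow> real"
    and E0 E3 :: "real \<Rightarrow> 'c \<Rightarrow> real" and E1 E2 :: "real^3 \<Rightarrow> 'c \<Rightarrow> real"
  assumes lin: "\<And>x. linear (\<lambda>c. E0 c x)" "\<And>x. linear (\<lambda>c. E1 c x)"
      "\<And>x. linear (\<lambda>c. E2 c x)" "\<And>x. linear (\<lambda>c. E3 c x)"
    and inj: "\<And>c. E0 c = (\<lambda>_. 0) \<Longrightarrow> c = 0" "\<And>c. E1 c = (\<lambda>_. 0) \<Longrightarrow> c = 0"
      "\<And>c. E2 c = (\<lambda>_. 0) \<Longrightarrow> c = 0" "\<And>c. E3 c = (\<lambda>_. 0) \<Longrightarrow> c = 0"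
    and C: "C 0 = range E0" "C 1 = range E1" "C 2 = range E2" "C 3 = range E3"
    and d: "\<And>c. d 0 (E0 c) = (\<lambda>_. 0)" "\<And>c. d 1 (E1 c) = E2 (vector [- c$3, 0, 0])"
      "\<And>c. d 2 (E2 c) = (\<lambda>_. 0)" "\<And>c. d 3 (E3 c) = (\<lambda>_. 0)"
  shows "(\<exists>\<phi> :: _ \<Rightarrow> real. cohomology_iso C d 0 \<phi>) \<and> (\<exists>\<phi> :: _ \<Rightarrow> real^2. cohomology_iso C d 1 \<phi>) \<and>
    (\<exists>\<phi> :: _ \<Rightarrow> real^2. cohomology_iso C d 2 \<phi>) \<and> (\<exists>\<phi> :: _ \<Rightarrow> real. cohomology_iso C d 3 \<phi>)"
proof (intro conjI)
  have E_0: "E0 0 = (\<lambda>_. 0)" "E1 0 = (\<lambda>_. 0)" "E2 0 = (\<lambda>_. 0)" "E3 0 = (\<lambda>_. 0)"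
    using linear_0[OF lin(1)] linear_0[OF lin(2)] linear_0[OF lin(3)] linear_0[OF lin(4)] by auto
  show "\<exists>\<phi> :: _ \<Rightarrow> real. cohomology_iso C d 0 \<phi>"
  proof (rule cohomology_iso_if_coordinates[where E = E0 and P = id and Z = UNIV])
    show "cocycles C d 0 = range E0"
      by (auto simp: cocycles_def C d)
    show "coboundaries C d 0 = E0 ` {c \<in> UNIV. id c = 0}"
      by (auto simp: coboundaries_def E_0)
  qed (use lin inj linear_id in auto)
  have vector_0: "vector [x, 0, 0] = (0 :: real^3) \<longleftrightarrow> x = 0" for x
    by (auto simp: vec_eq_iff forall_3)
  show "\<exists>\<phi> :: _ \<Rightarrow> real^2. cohomology_iso C d 1 \<phi>"
  proof (rule cohomology_iso_if_coordinates
      [where E = E1 and P = "\<lambda>c. vector [c$1, c$2] :: real^2" and Z = "{c. c$3 = 0}"])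
    show "subspace {c :: real^3. c$3 = 0}"
      by (auto simp: subspace_def)
    have "E2 (vector [- c$3, 0, 0]) = (\<lambda>_. 0) \<longleftrightarrow> c$3 = 0" for c :: "real^3"
      using inj(3) E_0(3) vector_0[of "- c$3"] by auto
    then have "d 1 (E1 c) = (\<lambda>_. 0) \<longleftrightarrow> c$3 = 0" for c
      unfolding d(2) .
    then show "cocycles C d 1 = E1 ` {c. c$3 = 0}"
      unfolding cocycles_def C(2) by blast
    have "{c \<in> {c :: real^3. c$3 = 0}. vector [c$1, c$2] = (0 :: real^2)} = {0}"
      by (auto simp: vec_eq_iff forall_2 forall_3)
    then show "coboundaries C d 1 = E1 ` {c \<in> {c. c$3 = 0}. vector [c$1, c$2] = (0 :: real^2)}"
      by (simp add: coboundaries_def E_0 C(1) d(1) image_image)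
    show "linear (\<lambda>c :: real^3. vector [c$1, c$2] :: real^2)"
      by (rule linearI) (simp_all add: vec_eq_iff forall_2)
    show "(\<lambda>c :: real^3. vector [c$1, c$2] :: real^2) ` {c. c$3 = 0} = UNIV"
    proof -
      have "v = (\<lambda>c :: real^3. vector [c$1, c$2]) (vector [v$1, v$2, 0])" for v :: "real^2"
        by (simp add: vec_eq_iff forall_2)
      moreover have "vector [v$1, v$2, 0] \<in> {c :: real^3. c$3 = 0}" for v :: "real^2"
        by simp
      ultimately show ?thesis by blast
    qed
  qed (use lin inj linear_id in auto)
  show "\<exists>\<phi> :: _ \<Rightarrow> real^2. cohomology_iso C d 2 \<phi>"
  proof (rule cohomology_iso_if_coordinates
      [where E = E2 and P = "\<lambda>c. vector [c$2, c$3] :: real^2" and Z = UNIV])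
    show "cocycles C d 2 = range E2"
      by (auto simp: cocycles_def C(3) d(3))
    have "{c \<in> UNIV. vector [c$2, c$3] = (0 :: real^2)} = range (\<lambda>c :: real^3. vector [- c$3, 0, 0] :: real^3)"
    proof safe
      fix c :: "real^3" assume "vector [c$2, c$3] = (0 :: real^2)"
      \<comment> \<open>\<open>c\<^sub>1 \<theta>\<^sub>1 \<and> \<theta>\<^sub>2\<close> is the differential of \<open>- c\<^sub>1 \<theta>\<^sub>3\<close>.\<close>
      then have "c = vector [- (vector [0, 0, - c$1] :: real^3)$3, 0, 0]"
        by (simp add: vec_eq_iff forall_2 forall_3)
      then show "c \<in> range (\<lambda>c :: real^3. vector [- c$3, 0, 0])"
        by blast
    qed (simp_all add: vec_eq_iff forall_2)
    then show "coboundaries C d 2 = E2 ` {c \<in> UNIV. vector [c$2, c$3] = (0 :: real^2)}"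
      using C(2) d(2) by (simp add: coboundaries_def numeral_2_eq_2 image_image)
    show "linear (\<lambda>c :: real^3. vector [c$2, c$3] :: real^2)"
      by (rule linearI) (simp_all add: vec_eq_iff forall_2)
    show "range (\<lambda>c :: real^3. vector [c$2, c$3] :: real^2) = UNIV"
    proof (rule surjI)
      show "vector [(vector [0, v$1, v$2] :: real^3)$2, (vector [0, v$1, v$2] :: real^3)$3] = v" for v :: "real^2"
        by (simp add: vec_eq_iff forall_2)
    qed
  qed (use lin inj linear_id in auto)
  show "\<exists>\<phi> :: _ \<Rightarrow> real. cohomology_iso C d 3 \<phi>"
  proof (rule cohomology_iso_if_coordinates[where E = E3 and P = id and Z = UNIV])
    show "cocycles C d 3 = range E3"
      by (auto simp: cocycles_def C(4) d(4))
    show "coboundaries C d 3 = E3 ` {c \<in> UNIV. id c = 0}"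
      using C(3) d(3) E_0(4) by (simp add: coboundaries_def numeral_3_eq_3 numeral_2_eq_2 image_image)
  qed (use lin inj linear_id in auto)
qed

section \<open>Alternating forms\<close>

lemma tuples_Cons_iff: "x # xs \<in> tuples V (Suc k) \<longleftrightarrow> x \<in> V \<and> xs \<in> tuples V k"
  by (auto simp: tuples_def)

lemma tuples_SucE:
  assumes "xs \<in> tuples V (Suc k)"
  obtains y ys where "xs = y # ys" "y \<in> V" "ys \<in> tuples V k"
  using assms by (cases xs) (auto simp: tuples_def)

lemma tuples_0_iff: "xs \<in> tuples V 0 \<longleftrightarrow> xs = []"
  by (auto simp: tuples_def)

lemma tuples_explicit:
  "xs \<in> tuples V 1 \<longleftrightarrow> (\<exists>x\<in>V. xs = [x])"
  "xs \<in> tuples V 2 \<longleftrightarrow> (\<exists>x\<in>V. \<exists>y\<in>V. xs = [x, y])"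
  "xs \<in> tuples V 3 \<longleftrightarrow> (\<exists>x\<in>V. \<exists>y\<in>V. \<exists>z\<in>V. xs = [x, y, z])"
  "xs \<in> tuples V 4 \<longleftrightarrow> (\<exists>x\<in>V. \<exists>y\<in>V. \<exists>z\<in>V. \<exists>w\<in>V. xs = [x, y, z, w])"
  by (auto simp: tuples_def eval_nat_numeral length_Suc_conv)

lemma alt_forms_add_head:
  assumes "\<omega> \<in> alt_forms V (Suc k)" "x \<in> V" "y \<in> V" "ys \<in> tuples V k"
  shows "\<omega> ((x + y) # ys) = \<omega> (x # ys) + \<omega> (y # ys)"
proof -
  have "x # ys \<in> tuples V (Suc k)"
    using assms by (simp add: tuples_Cons_iff)
  then have "\<omega> ((x # ys)[0 := x + y]) = \<omega> ((x # ys)[0 := x]) + \<omega> ((x # ys)[0 := y])"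
    using assms unfolding alt_forms_def by blast
  then show ?thesis by simp
qed

lemma alt_forms_scale_head:
  assumes "\<omega> \<in> alt_forms V (Suc k)" "x \<in> V" "ys \<in> tuples V k"
  shows "\<omega> ((r *\<^sub>R x) # ys) = r * \<omega> (x # ys)"
proof -
  have "x # ys \<in> tuples V (Suc k)"
    using assms by (simp add: tuples_Cons_iff)
  then have "\<omega> ((x # ys)[0 := r *\<^sub>R x]) = r * \<omega> ((x # ys)[0 := x])"
    using assms unfolding alt_forms_def by blast
  then show ?thesis by simp
qed

lemma alt_forms_repeat_eq_0:
  assumes "\<omega> \<in> alt_forms V (Suc (Suc k))" "x \<in> V" "ys \<in> tuples V k"
  shows "\<omega> (x # x # ys) = 0"
proof -
  have "x # x # ys \<in> tuples V (Suc (Suc k))"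
    using assms by (simp add: tuples_Cons_iff)
  moreover have "(x # x # ys) ! 0 = (x # x # ys) ! Suc 0"
    by simp
  ultimately show ?thesis
    using assms(1) unfolding alt_forms_def by blast
qed

text \<open>Contraction with a vector lowers the degree, so that facts about the first arguments of a form
  carry over to the later ones.\<close>

lemma alt_forms_contract:
  assumes \<omega>: "\<omega> \<in> alt_forms V (Suc k)" and x: "x \<in> V"
  shows "(\<lambda>ys. \<omega> (x # ys)) \<in> alt_forms V k"
proof -
  have add: "\<omega> (x # ys[i := y + z]) = \<omega> (x # ys[i := y]) + \<omega> (x # ys[i := z])"
    if "ys \<in> tuples V k" "i < k" "y \<in> V" "z \<in> V" for ys i y z
  proof -
    have "\<omega> ((x # ys)[Suc i := y + z]) = \<omega> ((x # ys)[Suc i := y]) + \<omega> ((x # ys)[Suc i := z])"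
      using \<omega> that x tuples_Cons_iff[of x ys V k] unfolding alt_forms_def by blast
    then show ?thesis by simp
  qed
  have scale: "\<omega> (x # ys[i := r *\<^sub>R y]) = r * \<omega> (x # ys[i := y])"
    if "ys \<in> tuples V k" "i < k" "y \<in> V" for ys i r y
  proof -
    have "\<omega> ((x # ys)[Suc i := r *\<^sub>R y]) = r * \<omega> ((x # ys)[Suc i := y])"
      using \<omega> that x tuples_Cons_iff[of x ys V k] unfolding alt_forms_def by blast
    then show ?thesis by simp
  qed
  have alt: "\<omega> (x # ys) = 0" if "ys \<in> tuples V k" "i < k" "j < k" "i \<noteq> j" "ys ! i = ys ! j" for ys i j
  proof -
    have "x # ys \<in> tuples V (Suc k)" "Suc i < Suc k" "Suc j < Suc k" "Suc i \<noteq> Suc j"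
      "(x # ys) ! Suc i = (x # ys) ! Suc j"
      using that x by (simp_all add: tuples_Cons_iff)
    then show ?thesis
      using \<omega> unfolding alt_forms_def by blast
  qed
  have "\<omega> (x # ys) = 0" if "ys \<notin> tuples V k" for ys
    using \<omega> that tuples_Cons_iff[of x ys V k] unfolding alt_forms_def by blast
  with add scale alt show ?thesis
    unfolding alt_forms_def by blast
qed

lemma alt_forms_swap:
  assumes \<omega>: "\<omega> \<in> alt_forms V (Suc (Suc k))" and V: "subspace V" and xy: "x \<in> V" "y \<in> V"
    and ys: "ys \<in> tuples V k"
  shows "\<omega> (x # y # ys) = - \<omega> (y # x # ys)"
proof -
  have tail: "\<omega> (u # (x + y) # ys) = \<omega> (u # x # ys) + \<omega> (u # y # ys)" if "u \<in> V" for u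
    using alt_forms_add_head[OF alt_forms_contract[OF \<omega> that]] xy ys by blast
  have s: "x + y \<in> V"
    using V xy by (simp add: subspace_add)
  have "\<omega> ((x + y) # (x + y) # ys) = \<omega> (x # (x + y) # ys) + \<omega> (y # (x + y) # ys)"
    using \<omega> xy s ys by (intro alt_forms_add_head) (auto simp: tuples_Cons_iff)
  then show ?thesis
    using alt_forms_repeat_eq_0[OF \<omega> _ ys] xy s tail by simp
qed

text \<open>Forms vanish on lists with entries outside \<open>V\<close>. For the pullback to do so,
  \<open>f\<close> must not map vectors from outside \<open>V\<close> into \<open>V\<close>, hence the equivalence in the last assumption.\<close>

lemma alt_forms_pullback:
  assumes \<omega>: "\<omega> \<in> alt_forms V k" and f: "linear f" and V: "\<And>x. f x \<in> V \<longleftrightarrow> x \<in> V"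
  shows "(\<lambda>xs. \<omega> (map f xs)) \<in> alt_forms V k"
proof -
  have tup: "map f xs \<in> tuples V k \<longleftrightarrow> xs \<in> tuples V k" for xs
    using V by (auto simp: tuples_def)
  have "\<omega> (map f xs) = 0" if "xs \<in> tuples V k" "i < k" "j < k" "i \<noteq> j" "xs ! i = xs ! j" for xs i j
  proof -
    have "map f xs \<in> tuples V k"
      using that(1) tup by blast
    moreover have "map f xs ! i = map f xs ! j"
      using that by (simp add: tuples_def)
    ultimately show ?thesis
      using \<omega> that unfolding alt_forms_def by blast
  qed
  then show ?thesis
    using \<omega> V tup unfolding alt_forms_def
    by (auto simp: map_update linear_add[OF f] linear_scale[OF f])
qed

section \<open>Alternating forms on a three-dimensional space\<close>

text \<open>The forms with constant coefficients in the coframe \<open>\<theta>\<close>. The coefficients of \<open>form2\<close> belong to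
  \<open>\<theta>\<^sub>1 \<and> \<theta>\<^sub>2\<close>, \<open>\<theta>\<^sub>1 \<and> \<theta>\<^sub>3\<close>, \<open>\<theta>\<^sub>2 \<and> \<theta>\<^sub>3\<close>, and \<open>form3\<close> is a multiple of the determinant, expanded
  along its first row.\<close>

definition form0 :: "'v set \<Rightarrow> real \<Rightarrow> 'v list \<Rightarrow> real" where
  "form0 V c xs = (if xs \<in> tuples V 0 then c else 0)"

definition form1 :: "'v set \<Rightarrow> (3 \<Rightarrow> 'v \<Rightarrow> real) \<Rightarrow> real^3 \<Rightarrow> 'v list \<Rightarrow> real" where
  "form1 V \<theta> c xs = (if xs \<in> tuples V 1 then \<Sum>i\<in>UNIV. c$i * \<theta> i (xs!0) else 0)"

definition form2 :: "'v set \<Rightarrow> (3 \<Rightarrow> 'v \<Rightarrow> real) \<Rightarrow> real^3 \<Rightarrow> 'v list \<Rightarrow> real" where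
  "form2 V \<theta> c xs = (if xs \<in> tuples V 2 then
     let W = (\<lambda>i j. \<theta> i (xs!0) * \<theta> j (xs!1) - \<theta> j (xs!0) * \<theta> i (xs!1))
     in c$1 * W 1 2 + c$2 * W 1 3 + c$3 * W 2 3 else 0)"

definition form3 :: "'v set \<Rightarrow> (3 \<Rightarrow> 'v \<Rightarrow> real) \<Rightarrow> real \<Rightarrow> 'v list \<Rightarrow> real" where
  "form3 V \<theta> c xs = (if xs \<in> tuples V 3 then
     let W = (\<lambda>i j. \<theta> i (xs!1) * \<theta> j (xs!2) - \<theta> j (xs!1) * \<theta> i (xs!2))
     in c * (\<theta> 1 (xs!0) * W 2 3 - \<theta> 2 (xs!0) * W 1 3 + \<theta> 3 (xs!0) * W 1 2) else 0)"

lemma form_linear: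
  "linear (\<lambda>c. form0 V c xs)" "linear (\<lambda>c. form1 V \<theta> c xs)"
  "linear (\<lambda>c. form2 V \<theta> c xs)" "linear (\<lambda>c. form3 V \<theta> c xs)"
  by (rule linearI; simp add: form0_def form1_def form2_def form3_def Let_def sum_3 algebra_simps)+

locale coframe3 =
  fixes V :: "'v::real_vector set" and \<theta> :: "3 \<Rightarrow> 'v \<Rightarrow> real" and b :: "3 \<Rightarrow> 'v"
  assumes V: "subspace V"
    and linear: "linear (\<theta> i)"
    and basis: "b i \<in> V"
    and dual: "\<theta> i (b j) = (if i = j then 1 else 0)"
    and expansion: "x \<in> V \<Longrightarrow> x = (\<Sum>i\<in>UNIV. \<theta> i x *\<^sub>R b i)"
begin

lemmas eval = form0_def form1_def form2_def form3_def tuples_def basis dual Let_def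

lemma form_eq_0:
  "form0 V c = (\<lambda>_. 0) \<Longrightarrow> c = 0" "form1 V \<theta> c' = (\<lambda>_. 0) \<Longrightarrow> c' = 0"
  "form2 V \<theta> c' = (\<lambda>_. 0) \<Longrightarrow> c' = 0" "form3 V \<theta> c = (\<lambda>_. 0) \<Longrightarrow> c = 0"
proof -
  assume "form0 V c = (\<lambda>_. 0)"
  then have "form0 V c [] = 0" by simp
  then show "c = 0" by (simp add: eval)
next
  assume "form1 V \<theta> c' = (\<lambda>_. 0)"
  then have "form1 V \<theta> c' [b i] = 0" for i by simp
  then show "c' = 0" by (simp add: eval vec_eq_iff if_distrib[of "(*) _"] cong: if_cong)
next
  assume "form2 V \<theta> c' = (\<lambda>_. 0)"
  then have "form2 V \<theta> c' [b 1, b 2] = 0" "form2 V \<theta> c' [b 1, b 3] = 0" "form2 V \<theta> c' [b 2, b 3] = 0"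
    by simp_all
  then show "c' = 0" by (simp add: eval vec_eq_iff forall_3)
next
  assume "form3 V \<theta> c = (\<lambda>_. 0)"
  then have "form3 V \<theta> c [b 1, b 2, b 3] = 0" by simp
  then show "c = 0" by (simp add: eval)
qed

lemma alt_forms_expand_head:
  assumes \<omega>: "\<omega> \<in> alt_forms V (Suc k)" and x: "x \<in> V" and ys: "ys \<in> tuples V k"
  shows "\<omega> (x # ys) = (\<Sum>i\<in>UNIV. \<theta> i x * \<omega> (b i # ys))"
proof -
  have mem: "r *\<^sub>R b i \<in> V" for r i
    using V basis by (simp add: subspace_scale)
  have "\<omega> (x # ys) = \<omega> ((\<theta> 1 x *\<^sub>R b 1 + \<theta> 2 x *\<^sub>R b 2 + \<theta> 3 x *\<^sub>R b 3) # ys)"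
    using expansion[OF x] by (simp add: sum_3)
  also have "\<dots> = (\<Sum>i\<in>UNIV. \<theta> i x * \<omega> (b i # ys))"
    using V mem basis ys by (simp add: sum_3 alt_forms_add_head[OF \<omega>] alt_forms_scale_head[OF \<omega>] subspace_add)
  finally show ?thesis .
qed

lemma form_mem:
  "form0 V c \<in> alt_forms V 0" "form1 V \<theta> c' \<in> alt_forms V 1"
  "form2 V \<theta> c' \<in> alt_forms V 2" "form3 V \<theta> c \<in> alt_forms V 3"
proof -
  note lin = linear_add[OF linear] linear_scale[OF linear]
  note sub = subspace_add[OF V] subspace_scale[OF V]
  have lt: "i < (1::nat) \<longleftrightarrow> i = 0" "i < (2::nat) \<longleftrightarrow> i = 0 \<or> i = 1"
    "i < (3::nat) \<longleftrightarrow> i = 0 \<or> i = 1 \<or> i = 2" for i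
    by auto
  show "form0 V c \<in> alt_forms V 0"
    by (simp add: alt_forms_def form0_def)
  show "form1 V \<theta> c' \<in> alt_forms V 1"
    unfolding alt_forms_def
  proof (intro CollectI conjI ballI allI impI)
    fix xs i x y assume *: "xs \<in> tuples V 1" "i < (1::nat)" "x \<in> V" "y \<in> V"
    then show "form1 V \<theta> c' (xs[i := x + y]) = form1 V \<theta> c' (xs[i := x]) + form1 V \<theta> c' (xs[i := y])"
      using *(1)[unfolded tuples_explicit] by (auto simp: form1_def tuples_def sub lin sum_3 algebra_simps)
  next
    fix xs i r x assume *: "xs \<in> tuples V 1" "i < (1::nat)" "x \<in> V"
    then show "form1 V \<theta> c' (xs[i := r *\<^sub>R x]) = r * form1 V \<theta> c' (xs[i := x])"
      using *(1)[unfolded tuples_explicit] by (auto simp: form1_def tuples_def sub lin sum_3 algebra_simps)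
  qed (auto simp: form1_def)
  show "form2 V \<theta> c' \<in> alt_forms V 2"
    unfolding alt_forms_def
  proof (intro CollectI conjI ballI allI impI)
    fix xs i x y assume *: "xs \<in> tuples V 2" "i < (2::nat)" "x \<in> V" "y \<in> V"
    then show "form2 V \<theta> c' (xs[i := x + y]) = form2 V \<theta> c' (xs[i := x]) + form2 V \<theta> c' (xs[i := y])"
      using *(1)[unfolded tuples_explicit] unfolding lt
      by (elim bexE exE disjE) (simp_all add: form2_def tuples_def Let_def sub lin, simp_all add: algebra_simps)
  next
    fix xs i r x assume *: "xs \<in> tuples V 2" "i < (2::nat)" "x \<in> V"
    then show "form2 V \<theta> c' (xs[i := r *\<^sub>R x]) = r * form2 V \<theta> c' (xs[i := x])"
      using *(1)[unfolded tuples_explicit] unfolding lt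
      by (elim bexE exE disjE) (simp_all add: form2_def tuples_def Let_def sub lin, simp_all add: algebra_simps)
  next
    fix xs i j assume *: "xs \<in> tuples V 2" "i < (2::nat)" "j < (2::nat)" "i \<noteq> j \<and> xs ! i = xs ! j"
    then have "xs ! 0 = xs ! 1"
      unfolding lt by auto
    then show "form2 V \<theta> c' xs = 0"
      by (simp add: form2_def Let_def)
  qed (auto simp: form2_def)
  show "form3 V \<theta> c \<in> alt_forms V 3"
    unfolding alt_forms_def
  proof (intro CollectI conjI ballI allI impI)
    fix xs i x y assume *: "xs \<in> tuples V 3" "i < (3::nat)" "x \<in> V" "y \<in> V"
    then show "form3 V \<theta> c (xs[i := x + y]) = form3 V \<theta> c (xs[i := x]) + form3 V \<theta> c (xs[i := y])"
      using *(1)[unfolded tuples_explicit] unfolding lt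
      by (elim bexE exE disjE) (simp_all add: form3_def tuples_def Let_def sub lin, simp_all add: algebra_simps)
  next
    fix xs i r x assume *: "xs \<in> tuples V 3" "i < (3::nat)" "x \<in> V"
    then show "form3 V \<theta> c (xs[i := r *\<^sub>R x]) = r * form3 V \<theta> c (xs[i := x])"
      using *(1)[unfolded tuples_explicit] unfolding lt
      by (elim bexE exE disjE) (simp_all add: form3_def tuples_def Let_def sub lin, simp_all add: algebra_simps)
  next
    fix xs i j assume *: "xs \<in> tuples V 3" "i < (3::nat)" "j < (3::nat)" "i \<noteq> j \<and> xs ! i = xs ! j"
    then have "xs ! 0 = xs ! 1 \<or> xs ! 0 = xs ! 2 \<or> xs ! 1 = xs ! 2"
      unfolding lt by auto
    then show "form3 V \<theta> c xs = 0"
      by (elim disjE) (simp_all add: form3_def Let_def algebra_simps)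
  qed (auto simp: form3_def)
qed

lemma alt_forms_0: "alt_forms V 0 = range (form0 V)"
proof
  show "alt_forms V 0 \<subseteq> range (form0 V)"
  proof
    fix \<omega> assume "\<omega> \<in> alt_forms V 0"
    then have "\<omega> = form0 V (\<omega> [])"
      by (auto simp: alt_forms_def form0_def tuples_0_iff)
    then show "\<omega> \<in> range (form0 V)" by blast
  qed
qed (auto simp: form_mem)

lemma form1_coeffs:
  assumes \<omega>: "\<omega> \<in> alt_forms V 1"
  shows "\<omega> = form1 V \<theta> (\<chi> i. \<omega> [b i])"
proof
  fix xs
  show "\<omega> xs = form1 V \<theta> (\<chi> i. \<omega> [b i]) xs"
  proof (cases "xs \<in> tuples V 1")
    case True
    then obtain x where "xs = [x]" "x \<in> V"
      by (auto elim!: tuples_SucE simp: tuples_0_iff)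
    then show ?thesis
      using True \<omega> alt_forms_expand_head[of \<omega> 0 x "[]"] by (simp add: form1_def tuples_0_iff mult.commute)
  qed (use \<omega> in \<open>auto simp: alt_forms_def form1_def\<close>)
qed

lemma form2_coeffs:
  assumes "\<omega> \<in> alt_forms V 2"
  shows "\<omega> = form2 V \<theta> (vector [\<omega> [b 1, b 2], \<omega> [b 1, b 3], \<omega> [b 2, b 3]])"
proof
  fix xs
  have \<omega>: "\<omega> \<in> alt_forms V (Suc (Suc 0))"
    using assms by (simp add: numeral_2_eq_2)
  show "\<omega> xs = form2 V \<theta> (vector [\<omega> [b 1, b 2], \<omega> [b 1, b 3], \<omega> [b 2, b 3]]) xs"
  proof (cases "xs \<in> tuples V 2")
    case True
    then obtain x y where xs: "xs = [x, y]" "x \<in> V" "y \<in> V"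
      by (auto elim!: tuples_SucE simp: tuples_0_iff numeral_2_eq_2)
    have "\<omega> [x, y] = (\<Sum>i\<in>UNIV. \<theta> i x * \<omega> [b i, y])"
      using alt_forms_expand_head[OF \<omega> xs(2), of "[y]"] xs by (simp add: tuples_def)
    also have "\<dots> = (\<Sum>i\<in>UNIV. \<theta> i x * (\<Sum>j\<in>UNIV. \<theta> j y * \<omega> [b i, b j]))"
      using alt_forms_expand_head[OF alt_forms_contract[OF \<omega> basis] xs(3), of "[]"] by (simp add: tuples_0_iff)
    finally have *: "\<omega> [x, y] = (\<Sum>i\<in>UNIV. \<theta> i x * (\<Sum>j\<in>UNIV. \<theta> j y * \<omega> [b i, b j]))" .
    have rep: "\<omega> [b i, b i] = 0" and swap: "\<omega> [b i, b j] = - \<omega> [b j, b i]" for i j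
      using alt_forms_repeat_eq_0[OF \<omega>, of "b i" "[]"] alt_forms_swap[OF \<omega> V basis basis, of "[]" i j]
      by (simp_all add: basis tuples_0_iff)
    show ?thesis
      using True unfolding xs(1) * by (simp add: form2_def Let_def sum_3 rep swap[of 2 1] swap[of 3 1] swap[of 3 2] algebra_simps)
  qed (use assms in \<open>auto simp: alt_forms_def form2_def\<close>)
qed

text \<open>Contracting with each \<open>b i\<close> leaves 2-forms with known coefficients; these are values of \<open>\<omega>\<close>
  on three basis vectors, each of which is zero or \<open>\<plusminus> \<omega>(b\<^sub>1, b\<^sub>2, b\<^sub>3)\<close>.\<close>

lemma form3_coeffs:
  assumes "\<omega> \<in> alt_forms V 3"
  shows "\<omega> = form3 V \<theta> (\<omega> [b 1, b 2, b 3])"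
proof
  fix xs
  have \<omega>: "\<omega> \<in> alt_forms V (Suc (Suc (Suc 0)))"
    using assms by (simp add: numeral_3_eq_3)
  show "\<omega> xs = form3 V \<theta> (\<omega> [b 1, b 2, b 3]) xs"
  proof (cases "xs \<in> tuples V 3")
    case True
    then obtain x y z where xs: "xs = [x, y, z]" "x \<in> V" "y \<in> V" "z \<in> V"
      by (auto elim!: tuples_SucE simp: tuples_0_iff numeral_3_eq_3)
    have contr: "(\<lambda>ys. \<omega> (b i # ys)) \<in> alt_forms V 2" for i
      using alt_forms_contract[OF \<omega> basis] by (simp add: numeral_2_eq_2)
    have *: "\<omega> [x, y, z] = (\<Sum>i\<in>UNIV. \<theta> i x * \<omega> [b i, y, z])"
      using alt_forms_expand_head[OF \<omega> xs(2), of "[y, z]"] xs by (simp add: tuples_def)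
    have **: "\<omega> [b i, y, z] =
        form2 V \<theta> (vector [\<omega> [b i, b 1, b 2], \<omega> [b i, b 1, b 3], \<omega> [b i, b 2, b 3]]) [y, z]" for i
      by (rule fun_cong[OF form2_coeffs[OF contr]])
    have rep: "\<omega> [b i, b i, b j] = 0" and swap: "\<omega> [b i, b j, b k] = - \<omega> [b j, b i, b k]" for i j k
      using alt_forms_repeat_eq_0[OF \<omega>, of "b i" "[b j]"] alt_forms_swap[OF \<omega> V basis basis, of "[b k]" i j]
      by (simp_all add: basis tuples_def)
    have swap': "\<omega> [b i, b j, b k] = - \<omega> [b i, b k, b j]" for i j k
      using alt_forms_swap[OF alt_forms_contract[OF \<omega> basis] V basis basis, of "[]" i j k]
      by (simp add: tuples_0_iff)
    have perm: "\<omega> [b 2, b 1, b 3] = - \<omega> [b 1, b 2, b 3]" "\<omega> [b 3, b 1, b 2] = \<omega> [b 1, b 2, b 3]"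
      "\<omega> [b 2, b 1, b 2] = 0" "\<omega> [b 3, b 1, b 3] = 0" "\<omega> [b 3, b 2, b 3] = 0"
      using swap[of 2 1 3] swap[of 3 1 2] swap'[of 1 3 2] swap[of 2 1 2] swap'[of 1 2 2]
        swap[of 3 1 3] swap'[of 1 3 3] swap[of 3 2 3] swap'[of 2 3 3] by linarith+
    show ?thesis
      using True xs(3,4) unfolding xs(1) * **
      by (simp add: form2_def form3_def tuples_def Let_def sum_3 rep perm algebra_simps)
  qed (use assms in \<open>auto simp: alt_forms_def form3_def\<close>)
qed

lemma alt_forms_eq_range:
  "alt_forms V 0 = range (form0 V)" "alt_forms V 1 = range (form1 V \<theta>)"
  "alt_forms V 2 = range (form2 V \<theta>)" "alt_forms V 3 = range (form3 V \<theta>)"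
proof -
  show "alt_forms V 0 = range (form0 V)"
    by (rule alt_forms_0)
  show "alt_forms V 1 = range (form1 V \<theta>)"
    using form_mem(2) form1_coeffs by blast
  show "alt_forms V 2 = range (form2 V \<theta>)"
    using form_mem(3) form2_coeffs by blast
  show "alt_forms V 3 = range (form3 V \<theta>)"
    using form_mem(4) form3_coeffs by blast
qed

end

section \<open>The Heisenberg algebra\<close>

definition heis_coord :: "3 \<Rightarrow> real^3^3 \<Rightarrow> real" where
  "heis_coord i X = (vector [X$1$2, X$2$3, X$1$3] :: real^3) $ i"

lemma heis_coord_simps [simp]:
  "heis_coord 1 X = X$1$2" "heis_coord 2 X = X$2$3" "heis_coord 3 X = X$1$3"
  by (simp_all add: heis_coord_def)

lemma coframe3_heis:
  assumes "a \<noteq> 0"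
  shows "coframe3 (heis_algebra a) heis_coord (heis_basis 1)"
proof (rule coframe3.intro)
  show "subspace (heis_algebra a)"
    by (simp add: heis_algebra_def)
  have "\<forall>i. linear (heis_coord i)"
    unfolding forall_3 by (auto intro!: linearI)
  then show "linear (heis_coord i)" for i
    by blast
  show "heis_basis 1 i \<in> heis_algebra a" for i
    using assms by (auto simp: heis_algebra_iff heis_basis_def elem_mat_def)
  have "\<forall>i j. heis_coord i (heis_basis 1 j) = (if i = j then 1 else 0)"
    unfolding forall_3 by (simp add: heis_basis_def elem_mat_def)
  then show "heis_coord i (heis_basis 1 j) = (if i = j then 1 else 0)" for i j
    by blast
  show "X = (\<Sum>i\<in>UNIV. heis_coord i X *\<^sub>R heis_basis 1 i)" if "X \<in> heis_algebra a" for X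
    unfolding heis_basis_sum using that assms
    by (simp add: vec_eq_iff forall_3 heis_algebra_iff)
qed

lemma heis_bracket:
  assumes "a \<noteq> 0" "heis_prelie a p" "X \<in> heis_algebra a" "Y \<in> heis_algebra a"
  shows "commutator p X Y = (X$1$2 * Y$2$3 - Y$1$2 * X$2$3) *\<^sub>R heis_basis 1 3"
proof -
  have "commutator p X Y = X ** Y - Y ** X"
    using heis_prelie_unique[OF assms(2) heis_prelie_matrix_mult] assms(3,4) by (simp add: commutator_def)
  also have "\<dots> = (X$1$2 * Y$2$3 - Y$1$2 * X$2$3) *\<^sub>R heis_basis 1 3"
    using assms by (simp add: heis_algebra_iff vec_eq_iff forall_3 matrix_matrix_mult_def sum_3
        heis_basis_def elem_mat_def)
  finally show ?thesis .
qed

text \<open>Every bracket is a multiple of the last basis vector, which only \<open>\<theta>\<^sub>3\<close> detects. In degree 2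
  the result is a combination of \<open>\<theta>\<^sub>1 \<and> \<theta>\<^sub>2 \<and> \<theta>\<^sub>1\<close> and \<open>\<theta>\<^sub>1 \<and> \<theta>\<^sub>2 \<and> \<theta>\<^sub>2\<close>, in degree 3 a multiple of
  \<open>\<theta>\<^sub>1 \<and> \<theta>\<^sub>2 \<and> \<theta>\<^sub>1 \<and> \<theta>\<^sub>2\<close>; these vanish by the polynomial identities that the simplifier checks.\<close>

lemma heis_lie_diff:
  assumes a: "a \<noteq> 0" and p: "heis_prelie a p"
  defines "V \<equiv> heis_algebra a"
  shows "lie_diff V (commutator p) 0 (form0 V c) = (\<lambda>_. 0)"
    and "lie_diff V (commutator p) 1 (form1 V heis_coord c') = form2 V heis_coord (vector [- c'$3, 0, 0])"
    and "lie_diff V (commutator p) 2 (form2 V heis_coord c') = (\<lambda>_. 0)"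
    and "lie_diff V (commutator p) 3 (form3 V heis_coord c) = (\<lambda>_. 0)"
proof -
  interpret coframe3 V heis_coord "heis_basis 1"
    unfolding V_def by (rule coframe3_heis[OF a])
  have br: "commutator p X Y = (X$1$2 * Y$2$3 - Y$1$2 * X$2$3) *\<^sub>R heis_basis 1 3"
    "commutator p X Y \<in> V" if "X \<in> V" "Y \<in> V" for X Y
    using heis_bracket[OF a p] that subspace_scale[OF V basis] by (simp_all add: V_def)
  have b3: "heis_basis 1 3 $ 1 $ 2 = 0" "heis_basis 1 3 $ 2 $ 3 = 0" "heis_basis 1 3 $ 1 $ 3 = 1"
    by (simp_all add: heis_basis_def elem_mat_def)
  have mem: "r *\<^sub>R heis_basis 1 3 \<in> V" for r
    by (rule subspace_scale[OF V basis])
  show "lie_diff V (commutator p) 0 (form0 V c) = (\<lambda>_. 0)"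
    by (simp add: lie_diff_def fun_eq_iff)
  show "lie_diff V (commutator p) 1 (form1 V heis_coord c') = form2 V heis_coord (vector [- c'$3, 0, 0])"
  proof
    fix xs
    show "lie_diff V (commutator p) 1 (form1 V heis_coord c') xs = form2 V heis_coord (vector [- c'$3, 0, 0]) xs"
    proof (cases "xs \<in> tuples V 2")
      case True
      then show ?thesis
        unfolding tuples_explicit
        by (auto simp: lie_diff_one_form[unfolded One_nat_def] form1_def form2_def tuples_def br(1) mem b3 sum_3)
    qed (simp add: lie_diff_def form2_def numeral_2_eq_2)
  qed
  show "lie_diff V (commutator p) 2 (form2 V heis_coord c') = (\<lambda>_. 0)"
  proof
    fix xs
    show "lie_diff V (commutator p) 2 (form2 V heis_coord c') xs = 0"
    proof (cases "xs \<in> tuples V 3")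
      case True
      then obtain x y z where xs: "xs = [x, y, z]" "x \<in> V" "y \<in> V" "z \<in> V"
        unfolding tuples_explicit by blast
      then show ?thesis
        using True
        by (simp add: lie_diff_def form2_def tuples_def numeral_2_eq_2 atMost_Suc lessThan_Suc
            nths_Cons br(1) mem b3) (simp add: algebra_simps)
    qed (simp add: lie_diff_def numeral_2_eq_2 numeral_3_eq_3)
  qed
  show "lie_diff V (commutator p) 3 (form3 V heis_coord c) = (\<lambda>_. 0)"
  proof
    fix xs
    show "lie_diff V (commutator p) 3 (form3 V heis_coord c) xs = 0"
    proof (cases "xs \<in> tuples V 4")
      case True
      then obtain x y z w where xs: "xs = [x, y, z, w]" "x \<in> V" "y \<in> V" "z \<in> V" "w \<in> V"
        unfolding tuples_explicit by blast
      then show ?thesis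
        using True
        by (simp add: lie_diff_def form3_def tuples_def numeral_2_eq_2 numeral_3_eq_3 atMost_Suc lessThan_Suc
            nths_Cons br(1) mem b3) (simp add: algebra_simps)
    qed (simp add: lie_diff_def eval_nat_numeral)
  qed
qed

section \<open>Left-invariant forms on the Heisenberg group\<close>

text \<open>An explicit inverse, as the proofs need its entries to be polynomials in those of \<open>g\<close>.\<close>

definition heis_inv :: "real^3^3 \<Rightarrow> real^3^3" where
  "heis_inv g =
     vector [vector [1, - g$1$2, g$1$2 * g$2$3 - g$1$3], vector [0, 1, - g$2$3], vector [0, 0, 1]]"

lemma heis_inv:
  assumes "a \<noteq> 0" "g \<in> heis_group a"
  shows "heis_inv g \<in> heis_group a" "g ** heis_inv g = mat 1" "heis_inv g ** g = mat 1"
  using assms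
  by (simp_all add: heis_group_iff heis_inv_def vec_eq_iff forall_3 matrix_matrix_mult_def sum_3 mat_def)

lemma heis_inv_mult:
  assumes "a \<noteq> 0" "h \<in> heis_group a" "g \<in> heis_group a"
  shows "heis_inv (h ** g) ** h = heis_inv g"
  using assms
  by (simp add: heis_group_iff heis_inv_def vec_eq_iff forall_3 matrix_matrix_mult_def sum_3 algebra_simps)

lemma heis_inv_one: "heis_inv (mat 1) = mat 1"
  by (simp add: heis_inv_def vec_eq_iff forall_3 mat_def)

lemma heis_group_mult_algebra_iff:
  assumes a: "a \<noteq> 0" and g: "g \<in> heis_group a"
  shows "g ** X \<in> heis_algebra a \<longleftrightarrow> X \<in> heis_algebra a"
proof -
  have mem: "h ** Y \<in> heis_algebra a" if "h \<in> heis_group a" "Y \<in> heis_algebra a" for h Y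
    using a that by (simp add: heis_group_iff heis_algebra_iff forall_3 matrix_matrix_mult_def sum_3)
  have "heis_inv g ** (g ** X) = X"
    using heis_inv(3)[OF a g] by (simp add: matrix_mul_assoc)
  then show ?thesis
    using mem heis_inv(1)[OF a g] g by metis
qed

lemma linear_matrix_mult: "linear ((**) (g :: real^3^3))"
  by (rule linearI) (simp_all add: vec_eq_iff matrix_matrix_mult_def sum_distrib_left sum.distrib algebra_simps)

text \<open>The left-invariant coframe \<open>dx, dy, dz - x dy\<close>.\<close>

lemma heis_inv_mult_coord:
  assumes "a \<noteq> 0" "X \<in> heis_algebra a"
  shows "(heis_inv g ** X) $ 1 $ 2 = X$1$2" "(heis_inv g ** X) $ 2 $ 3 = X$2$3"
    "(heis_inv g ** X) $ 1 $ 3 = X$1$3 - g$1$2 * X$2$3"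
  using assms by (simp_all add: heis_algebra_iff heis_inv_def matrix_matrix_mult_def sum_3)

lemma heis_group_line:
  assumes "a \<noteq> 0" "g \<in> heis_group a" "v \<in> heis_algebra a"
  shows "g + t *\<^sub>R v \<in> heis_group a"
  using assms by (simp add: heis_group_iff heis_algebra_iff)

lemma has_field_derivative_affine_along_line:
  fixes f :: "real^3^3 \<Rightarrow> real"
  assumes a: "a \<noteq> 0" and f: "\<And>h. h \<in> heis_group a \<Longrightarrow> f h = A + B * h$1$2"
    and g: "g \<in> heis_group a" and v: "v \<in> heis_algebra a"
  shows "((\<lambda>t. f (g + t *\<^sub>R v)) has_field_derivative B * v$1$2) (at 0)"
proof -
  have "(\<lambda>t. f (g + t *\<^sub>R v)) = (\<lambda>t. A + B * (g$1$2 + t * v$1$2))"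
    using heis_group_line[OF a g v] by (simp add: f)
  then show ?thesis
    by (auto intro!: derivative_eq_intros)
qed

lemma dir_deriv_affine:
  fixes f :: "real^3^3 \<Rightarrow> real"
  assumes "a \<noteq> 0" and "\<And>h. h \<in> heis_group a \<Longrightarrow> f h = A + B * h$1$2"
    and "g \<in> heis_group a" and "v \<in> heis_algebra a"
  shows "dir_deriv f v g = B * v$1$2"
  unfolding dir_deriv_def
  by (rule DERIV_imp_deriv[OF has_field_derivative_affine_along_line[OF assms]])

text \<open>Functions that are affine in the (1,2) entry are closed under directional derivatives, which are
  constant on the group. Nothing is said about \<open>f\<close> off the group, because the extensions of forms
  below jump to zero there.\<close>

lemma smooth_affine:
  fixes f :: "real^3^3 \<Rightarrow> real"
  assumes a: "a \<noteq> 0" and f: "\<And>h. h \<in> heis_group a \<Longrightarrow> f h = A + B * h$1$2"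
  shows "smooth_fun_on (heis_group a) (heis_algebra a) f"
proof -
  have "Ck_on n (heis_group a) (heis_algebra a) f" for n
    using f
  proof (induction n arbitrary: f A B)
    case 0
    have "continuous_on (heis_group a) (\<lambda>h. A + B * h$1$2)"
      by (intro continuous_intros)
    then show ?case
      using 0 by (simp cong: continuous_on_cong)
  next
    case (Suc n)
    have "continuous_on (heis_group a) (\<lambda>h. A + B * h$1$2)"
      by (intro continuous_intros)
    then have "continuous_on (heis_group a) f"
      using Suc.prems by (simp cong: continuous_on_cong)
    moreover have "Ck_on n (heis_group a) (heis_algebra a) (dir_deriv f v)" if "v \<in> heis_algebra a" for v
      using dir_deriv_affine[OF a Suc.prems _ that] by (intro Suc.IH[of _ "B * v$1$2" 0]) simp
    moreover have "(\<lambda>t. f (g + t *\<^sub>R v)) field_differentiable (at 0)"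
      if "g \<in> heis_group a" "v \<in> heis_algebra a" for g v
      using has_field_derivative_affine_along_line[OF a Suc.prems that] by (auto simp: field_differentiable_def)
    ultimately show ?case by simp
  qed
  then show ?thesis by (simp add: smooth_fun_on_def)
qed

text \<open>The left-invariant form with value \<open>\<eta>\<close> at the identity.\<close>

definition invariant_extension ::
    "(real^3^3) set \<Rightarrow> ((real^3^3) list \<Rightarrow> real) \<Rightarrow> (real^3^3) \<times> (real^3^3) list \<Rightarrow> real" where
  "invariant_extension G \<eta> = (\<lambda>(g, xs). if g \<in> G then \<eta> (map ((**) (heis_inv g)) xs) else 0)"

lemma mat_1_heis_group: "mat 1 \<in> heis_group a"
  unfolding heis_group_def heis_algebra_def using span_zero by force

lemma invariant_extension_at_1: "invariant_extension (heis_group a) \<eta> (mat 1, xs) = \<eta> xs"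
proof -
  have "(**) (mat 1) = (id :: real^3^3 \<Rightarrow> _)"
    by auto
  then show ?thesis
    by (simp add: invariant_extension_def mat_1_heis_group heis_inv_one)
qed

lemma invariant_extension_eq_0:
  "invariant_extension (heis_group a) \<eta> = (\<lambda>_. 0) \<Longrightarrow> \<eta> = (\<lambda>_. 0)"
  using invariant_extension_at_1[of a \<eta>] by (simp add: fun_eq_iff)

lemma tuples_map_heis:
  assumes "a \<noteq> 0" "g \<in> heis_group a"
  shows "map ((**) g) xs \<in> tuples (heis_algebra a) k \<longleftrightarrow> xs \<in> tuples (heis_algebra a) k"
  using heis_group_mult_algebra_iff[OF assms] by (auto simp: tuples_def)

lemma left_invariant_form_determined:
  assumes a: "a \<noteq> 0" and \<omega>: "\<omega> \<in> left_invariant_forms (heis_group a) (heis_algebra a) k"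
  shows "(\<lambda>xs. \<omega> (mat 1, xs)) \<in> alt_forms (heis_algebra a) k"
    and "\<omega> = invariant_extension (heis_group a) (\<lambda>xs. \<omega> (mat 1, xs))"
proof -
  let ?G = "heis_group a" and ?V = "heis_algebra a"
  have inv: "\<omega> (h ** g, map ((**) h) xs) = \<omega> (g, xs)"
    if "h \<in> ?G" "g \<in> ?G" "xs \<in> tuples ?V k" for h g xs
    using \<omega> that by (auto simp: left_invariant_forms_def)
  have diff: "\<omega> \<in> diff_forms ?G ?V k"
    using \<omega> by (simp add: left_invariant_forms_def)
  then have alt: "(\<lambda>xs. \<omega> (g, xs)) \<in> alt_forms ?V k" if "g \<in> ?G" for g
    using that by (simp add: diff_forms_def)
  show "(\<lambda>xs. \<omega> (mat 1, xs)) \<in> alt_forms ?V k"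
    by (rule alt[OF mat_1_heis_group])
  show "\<omega> = invariant_extension ?G (\<lambda>xs. \<omega> (mat 1, xs))"
  proof
    fix gx :: "(real^3^3) \<times> (real^3^3) list"
    obtain g xs where gx: "gx = (g, xs)" by fastforce
    show "\<omega> gx = invariant_extension ?G (\<lambda>xs. \<omega> (mat 1, xs)) gx"
    proof (cases "g \<in> ?G")
      case False
      then show ?thesis
        using diff by (simp add: gx invariant_extension_def diff_forms_def)
    next
      case g: True
      note g' = heis_inv[OF a g]
      show ?thesis
      proof (cases "xs \<in> tuples ?V k")
        case True
        then show ?thesis
          using inv[OF g'(1) g True] g g' by (simp add: gx invariant_extension_def)
      next
        case False
        then have "map ((**) (heis_inv g)) xs \<notin> tuples ?V k"
          using tuples_map_heis[OF a g'(1)] by blast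
        then show ?thesis
          using False g alt[OF g] alt[OF mat_1_heis_group]
          by (simp add: gx invariant_extension_def alt_forms_def)
      qed
    qed
  qed
qed

text \<open>Invariance and multilinearity are automatic; smoothness is where the shape of the
  coefficients enters.\<close>

lemma invariant_extension_mem:
  assumes a: "a \<noteq> 0" and \<eta>: "\<eta> \<in> alt_forms (heis_algebra a) k"
    and affine: "\<And>xs. xs \<in> tuples (heis_algebra a) k \<Longrightarrow>
      \<exists>A B. \<forall>g\<in>heis_group a. \<eta> (map ((**) (heis_inv g)) xs) = A + B * g$1$2"
  shows "invariant_extension (heis_group a) \<eta> \<in> left_invariant_forms (heis_group a) (heis_algebra a) k"
proof -
  let ?G = "heis_group a" and ?V = "heis_algebra a" and ?\<omega> = "invariant_extension (heis_group a) \<eta>"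
  have "(\<lambda>xs. ?\<omega> (g, xs)) \<in> alt_forms ?V k" if "g \<in> ?G" for g
    using alt_forms_pullback[OF \<eta> linear_matrix_mult heis_group_mult_algebra_iff[OF a heis_inv(1)[OF a that]]]
    by (simp add: invariant_extension_def that)
  moreover have "smooth_fun_on ?G ?V (\<lambda>g. ?\<omega> (g, xs))" if xs: "xs \<in> tuples ?V k" for xs
  proof -
    obtain A B where "\<forall>g\<in>?G. \<eta> (map ((**) (heis_inv g)) xs) = A + B * g$1$2"
      using affine[OF xs] by blast
    then show ?thesis
      by (intro smooth_affine[OF a, where A = A and B = B]) (simp add: invariant_extension_def)
  qed
  moreover have "?\<omega> (h ** g, map ((**) h) xs) = ?\<omega> (g, xs)" if "h \<in> ?G" "g \<in> ?G" for h g xs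
  proof -
    have "(**) (heis_inv (h ** g)) \<circ> (**) h = ((**) (heis_inv g) :: real^3^3 \<Rightarrow> _)"
      using heis_inv_mult[OF a that] by (auto simp: matrix_mul_assoc)
    then show ?thesis
      using that heis_group_mult[OF a] by (simp add: invariant_extension_def)
  qed
  ultimately show ?thesis
    by (simp add: left_invariant_forms_def diff_forms_def) (simp add: invariant_extension_def)
qed

text \<open>Substituting \<open>dz - x dy\<close> for \<open>\<theta>\<^sub>3\<close> changes a form by a multiple of \<open>x\<close>. The change of
  \<open>\<theta>\<^sub>1 \<and> \<theta>\<^sub>3\<close> is \<open>- x dx \<and> dy\<close>, while \<open>\<theta>\<^sub>2 \<and> \<theta>\<^sub>3\<close> and \<open>\<theta>\<^sub>1 \<and> \<theta>\<^sub>2 \<and> \<theta>\<^sub>3\<close> do not change, since they already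
  contain \<open>dy\<close>. The right-hand sides have the form \<open>A + B x\<close> to which \<open>dir_deriv_affine\<close> applies.\<close>

lemma invariant_extension_form:
  fixes a :: real
  assumes a: "a \<noteq> 0"
  defines "V \<equiv> heis_algebra a" and "G \<equiv> heis_group a"
  assumes g: "g \<in> G" and V: "x \<in> V" "y \<in> V" "z \<in> V"
  shows "invariant_extension G (form0 V c) (g, []) = c"
    and "invariant_extension G (form1 V heis_coord c') (g, [x]) =
      (c'$1 * x$1$2 + c'$2 * x$2$3 + c'$3 * x$1$3) + (- c'$3 * x$2$3) * g$1$2"
    and "invariant_extension G (form2 V heis_coord c') (g, [x, y]) =
      form2 V heis_coord c' [x, y] + (- c'$2 * (x$1$2 * y$2$3 - y$1$2 * x$2$3)) * g$1$2"
    and "invariant_extension G (form3 V heis_coord c) (g, [x, y, z]) = form3 V heis_coord c [x, y, z]"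
proof -
  have mem: "heis_inv g ** u \<in> V" if "u \<in> V" for u
    using heis_group_mult_algebra_iff[OF a heis_inv(1)[OF a]] g that by (simp add: V_def G_def)
  have coord: "(heis_inv g ** u) $ 1 $ 2 = u$1$2" "(heis_inv g ** u) $ 2 $ 3 = u$2$3"
    "(heis_inv g ** u) $ 1 $ 3 = u$1$3 - g$1$2 * u$2$3" if "u \<in> V" for u
    using heis_inv_mult_coord[OF a] that by (simp_all add: V_def)
  show "invariant_extension G (form0 V c) (g, []) = c"
    using g by (simp add: invariant_extension_def form0_def tuples_def)
  show "invariant_extension G (form1 V heis_coord c') (g, [x]) =
      (c'$1 * x$1$2 + c'$2 * x$2$3 + c'$3 * x$1$3) + (- c'$3 * x$2$3) * g$1$2"
    using g V mem by (simp add: invariant_extension_def form1_def tuples_def sum_3 coord algebra_simps)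
  show "invariant_extension G (form2 V heis_coord c') (g, [x, y]) =
      form2 V heis_coord c' [x, y] + (- c'$2 * (x$1$2 * y$2$3 - y$1$2 * x$2$3)) * g$1$2"
    using g V mem by (simp add: invariant_extension_def form2_def tuples_def Let_def coord) (simp add: algebra_simps)
  show "invariant_extension G (form3 V heis_coord c) (g, [x, y, z]) = form3 V heis_coord c [x, y, z]"
    using g V mem by (simp add: invariant_extension_def form3_def tuples_def Let_def coord) (simp add: algebra_simps)
qed

lemma left_invariant_forms_eq_range:
  fixes a :: real
  assumes a: "a \<noteq> 0"
  defines "V \<equiv> heis_algebra a" and "G \<equiv> heis_group a"
  shows "left_invariant_forms G V 0 = range (\<lambda>c. invariant_extension G (form0 V c))"
    and "left_invariant_forms G V 1 = range (\<lambda>c. invariant_extension G (form1 V heis_coord c))"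
    and "left_invariant_forms G V 2 = range (\<lambda>c. invariant_extension G (form2 V heis_coord c))"
    and "left_invariant_forms G V 3 = range (\<lambda>c. invariant_extension G (form3 V heis_coord c))"
proof -
  interpret coframe3 V heis_coord "heis_basis 1"
    unfolding V_def by (rule coframe3_heis[OF a])
  have extension: "left_invariant_forms G V k = range (\<lambda>c. invariant_extension G (E c))"
    if range: "alt_forms V k = range E"
      and affine: "\<And>c xs. xs \<in> tuples V k \<Longrightarrow>
        \<exists>A B. \<forall>g\<in>G. invariant_extension G (E c) (g, xs) = A + B * g$1$2"
    for k and E :: "'b \<Rightarrow> _"
  proof
    show "left_invariant_forms G V k \<subseteq> range (\<lambda>c. invariant_extension G (E c))"
    proof
      fix \<omega> assume \<omega>: "\<omega> \<in> left_invariant_forms G V k"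
      then obtain c where "(\<lambda>xs. \<omega> (mat 1, xs)) = E c"
        using left_invariant_form_determined(1)[OF a \<omega>[unfolded V_def G_def]] range unfolding V_def by blast
      then show "\<omega> \<in> range (\<lambda>c. invariant_extension G (E c))"
        using left_invariant_form_determined(2)[OF a \<omega>[unfolded V_def G_def]] by (auto simp: G_def)
    qed
    have "invariant_extension G (E c) \<in> left_invariant_forms G V k" for c
      using range affine[of _ c] unfolding V_def G_def
      by (intro invariant_extension_mem[OF a]) (auto simp: invariant_extension_def)
    then show "range (\<lambda>c. invariant_extension G (E c)) \<subseteq> left_invariant_forms G V k"
      by blast
  qed
  note translate = invariant_extension_form[OF a, folded V_def G_def]
  show "left_invariant_forms G V 0 = range (\<lambda>c. invariant_extension G (form0 V c))"
  proof (rule extension[OF alt_forms_eq_range(1)])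
    fix c xs assume "xs \<in> tuples V 0"
    then show "\<exists>A B. \<forall>g\<in>G. invariant_extension G (form0 V c) (g, xs) = A + B * g$1$2"
      using translate(1)[of _ 0 0 0] subspace_0[OF V] by (intro exI[of _ c] exI[of _ 0]) (auto simp: tuples_0_iff)
  qed
  show "left_invariant_forms G V 1 = range (\<lambda>c. invariant_extension G (form1 V heis_coord c))"
  proof (rule extension[OF alt_forms_eq_range(2)])
    fix c xs assume "xs \<in> tuples V 1"
    then show "\<exists>A B. \<forall>g\<in>G. invariant_extension G (form1 V heis_coord c) (g, xs) = A + B * g$1$2"
      unfolding tuples_explicit using translate(2) by blast
  qed
  show "left_invariant_forms G V 2 = range (\<lambda>c. invariant_extension G (form2 V heis_coord c))"
  proof (rule extension[OF alt_forms_eq_range(3)])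
    fix c xs assume "xs \<in> tuples V 2"
    then show "\<exists>A B. \<forall>g\<in>G. invariant_extension G (form2 V heis_coord c) (g, xs) = A + B * g$1$2"
      unfolding tuples_explicit using translate(3) by blast
  qed
  show "left_invariant_forms G V 3 = range (\<lambda>c. invariant_extension G (form3 V heis_coord c))"
  proof (rule extension[OF alt_forms_eq_range(4)])
    fix c xs assume "xs \<in> tuples V 3"
    then show "\<exists>A B. \<forall>g\<in>G. invariant_extension G (form3 V heis_coord c) (g, xs) = A + B * g$1$2"
      using translate(4) by (intro exI[of _ "form3 V heis_coord c xs"] exI[of _ 0]) (auto simp: tuples_explicit)
  qed
qed

text \<open>Only the coefficient of \<open>x\<close> survives differentiation. In degree 1 this leaves
  \<open>- c\<^sub>3 dx \<and> dy\<close>, in degree 2 a multiple of \<open>dx \<and> dx \<and> dy = 0\<close>, and in degrees 0 and 3 the coefficients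
  are constant.\<close>

lemma heis_ext_deriv:
  fixes a :: real
  assumes a: "a \<noteq> 0"
  defines "V \<equiv> heis_algebra a" and "G \<equiv> heis_group a"
  shows "ext_deriv G V 0 (invariant_extension G (form0 V c)) = (\<lambda>_. 0)"
    and "ext_deriv G V 1 (invariant_extension G (form1 V heis_coord c')) =
      invariant_extension G (form2 V heis_coord (vector [- c'$3, 0, 0]))"
    and "ext_deriv G V 2 (invariant_extension G (form2 V heis_coord c')) = (\<lambda>_. 0)"
    and "ext_deriv G V 3 (invariant_extension G (form3 V heis_coord c)) = (\<lambda>_. 0)"
proof -
  note translate = invariant_extension_form[OF a, folded V_def G_def]
  note deriv = dir_deriv_affine[OF a, folded V_def G_def]
  have d0: "dir_deriv (\<lambda>h. invariant_extension G (form0 V c) (h, [])) x g = 0"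
    if "g \<in> G" "x \<in> V" for g x
    using deriv[of _ c 0, OF _ that] translate(1)[OF _ that(2) that(2) that(2)] by simp
  have d1: "dir_deriv (\<lambda>h. invariant_extension G (form1 V heis_coord c') (h, [y])) x g = (- c'$3 * y$2$3) * x$1$2"
    if "g \<in> G" "x \<in> V" "y \<in> V" for g x y
    by (rule deriv[OF translate(2)]) (use that in auto)
  have d2: "dir_deriv (\<lambda>h. invariant_extension G (form2 V heis_coord c') (h, [y, z])) x g =
      (- c'$2 * (y$1$2 * z$2$3 - z$1$2 * y$2$3)) * x$1$2"
    if "g \<in> G" "x \<in> V" "y \<in> V" "z \<in> V" for g x y z
    by (rule deriv[OF translate(3)]) (use that in auto)
  have d3: "dir_deriv (\<lambda>h. invariant_extension G (form3 V heis_coord c) (h, [y, z, w])) x g = 0"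
    if "g \<in> G" "x \<in> V" "y \<in> V" "z \<in> V" "w \<in> V" for g x y z w
    using deriv[of _ "form3 V heis_coord c [y, z, w]" 0, OF _ that(1,2)] translate(4)[OF _ that(3-5)] by simp
  show "ext_deriv G V 0 (invariant_extension G (form0 V c)) = (\<lambda>_. 0)"
    by (auto simp: ext_deriv_def fun_eq_iff tuples_explicit[unfolded One_nat_def] d0 nths_Cons)
  show "ext_deriv G V 1 (invariant_extension G (form1 V heis_coord c')) =
      invariant_extension G (form2 V heis_coord (vector [- c'$3, 0, 0]))"
  proof
    fix gx :: "(real^3^3) \<times> (real^3^3) list"
    obtain g xs where gx: "gx = (g, xs)" by fastforce
    show "ext_deriv G V 1 (invariant_extension G (form1 V heis_coord c')) gx =
      invariant_extension G (form2 V heis_coord (vector [- c'$3, 0, 0])) gx"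
    proof (cases "g \<in> G \<and> xs \<in> tuples V 2")
      case True
      then obtain x y where xs: "xs = [x, y]" "x \<in> V" "y \<in> V"
        unfolding tuples_explicit by blast
      then have "ext_deriv G V 1 (invariant_extension G (form1 V heis_coord c')) (g, [x, y]) =
          - c'$3 * y$2$3 * x$1$2 + c'$3 * x$2$3 * y$1$2"
        using True by (simp add: ext_deriv_def tuples_def nths_Cons d1[unfolded One_nat_def])
      moreover have "invariant_extension G (form2 V heis_coord (vector [- c'$3, 0, 0])) (g, [x, y]) =
          - c'$3 * (x$1$2 * y$2$3 - y$1$2 * x$2$3)"
        using True xs translate(3)[of g x y x "vector [- c'$3, 0, 0]"]
        by (simp add: form2_def tuples_def Let_def)
      ultimately show ?thesis
        by (simp add: gx xs(1) algebra_simps)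
    next
      case False
      then have "g \<in> G \<Longrightarrow> map ((**) (heis_inv g)) xs \<notin> tuples V 2"
        using tuples_map_heis[OF a heis_inv(1)[OF a]] by (simp add: V_def G_def)
      then show ?thesis
        using False by (auto simp: gx ext_deriv_def invariant_extension_def form2_def numeral_2_eq_2)
    qed
  qed
  show "ext_deriv G V 2 (invariant_extension G (form2 V heis_coord c')) = (\<lambda>_. 0)"
  proof
    fix gx :: "(real^3^3) \<times> (real^3^3) list"
    obtain g xs where gx: "gx = (g, xs)" by fastforce
    show "ext_deriv G V 2 (invariant_extension G (form2 V heis_coord c')) gx = 0"
    proof (cases "g \<in> G \<and> xs \<in> tuples V 3")
      case True
      then obtain x y z where "xs = [x, y, z]" "x \<in> V" "y \<in> V" "z \<in> V"
        unfolding tuples_explicit by blast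
      then show ?thesis
        using True by (simp add: gx ext_deriv_def tuples_def numeral_2_eq_2 atMost_Suc nths_Cons d2)
          (simp add: algebra_simps)
    qed (auto simp: gx ext_deriv_def numeral_2_eq_2 numeral_3_eq_3)
  qed
  show "ext_deriv G V 3 (invariant_extension G (form3 V heis_coord c)) = (\<lambda>_. 0)"
  proof
    fix gx :: "(real^3^3) \<times> (real^3^3) list"
    obtain g xs where gx: "gx = (g, xs)" by fastforce
    show "ext_deriv G V 3 (invariant_extension G (form3 V heis_coord c)) gx = 0"
    proof (cases "g \<in> G \<and> xs \<in> tuples V 4")
      case True
      then obtain x y z w where "xs = [x, y, z, w]" "x \<in> V" "y \<in> V" "z \<in> V" "w \<in> V"
        unfolding tuples_explicit by blast
      then show ?thesis
        using True by (simp add: gx ext_deriv_def tuples_def numeral_3_eq_3 atMost_Suc nths_Cons d3)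
    qed (auto simp: gx ext_deriv_def eval_nat_numeral)
  qed
qed

theorem theorem25:
  fixes a :: real and p :: "real^3^3 \<Rightarrow> real^3^3 \<Rightarrow> real^3^3"
  assumes "a > 0"
    and "heis_prelie a p"
  shows
    "(\<exists>\<phi> :: _ \<Rightarrow> real. cohomology_iso (alt_forms (heis_algebra a)) (lie_diff (heis_algebra a) (commutator p)) 0 \<phi>) \<and>
     (\<exists>\<phi> :: _ \<Rightarrow> real^2. cohomology_iso (alt_forms (heis_algebra a)) (lie_diff (heis_algebra a) (commutator p)) 1 \<phi>) \<and>
     (\<exists>\<phi> :: _ \<Rightarrow> real^2. cohomology_iso (alt_forms (heis_algebra a)) (lie_diff (heis_algebra a) (commutator p)) 2 \<phi>) \<and>
     (\<exists>\<phi> :: _ \<Rightarrow> real. cohomology_iso (alt_forms (heis_algebra a)) (lie_diff (heis_algebra a) (commutator p)) 3 \<phi>) \<and>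
     (\<exists>\<phi> :: _ \<Rightarrow> real. cohomology_iso (left_invariant_forms (heis_group a) (heis_algebra a))
           (ext_deriv (heis_group a) (heis_algebra a)) 0 \<phi>) \<and>
     (\<exists>\<phi> :: _ \<Rightarrow> real^2. cohomology_iso (left_invariant_forms (heis_group a) (heis_algebra a))
           (ext_deriv (heis_group a) (heis_algebra a)) 1 \<phi>) \<and>
     (\<exists>\<phi> :: _ \<Rightarrow> real^2. cohomology_iso (left_invariant_forms (heis_group a) (heis_algebra a))
           (ext_deriv (heis_group a) (heis_algebra a)) 2 \<phi>) \<and>
     (\<exists>\<phi> :: _ \<Rightarrow> real. cohomology_iso (left_invariant_forms (heis_group a) (heis_algebra a))
           (ext_deriv (heis_group a) (heis_algebra a)) 3 \<phi>)"
proof -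
  let ?V = "heis_algebra a" and ?G = "heis_group a"
  have a: "a \<noteq> 0"
    using assms(1) by simp
  interpret coframe3 ?V heis_coord "heis_basis 1"
    by (rule coframe3_heis[OF a])
  have algebra: "(\<exists>\<phi> :: _ \<Rightarrow> real. cohomology_iso (alt_forms ?V) (lie_diff ?V (commutator p)) 0 \<phi>) \<and>
     (\<exists>\<phi> :: _ \<Rightarrow> real^2. cohomology_iso (alt_forms ?V) (lie_diff ?V (commutator p)) 1 \<phi>) \<and>
     (\<exists>\<phi> :: _ \<Rightarrow> real^2. cohomology_iso (alt_forms ?V) (lie_diff ?V (commutator p)) 2 \<phi>) \<and>
     (\<exists>\<phi> :: _ \<Rightarrow> real. cohomology_iso (alt_forms ?V) (lie_diff ?V (commutator p)) 3 \<phi>)"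
    by (rule cohomology_of_heisenberg_coordinates[OF form_linear form_eq_0 alt_forms_eq_range
          heis_lie_diff[OF a assms(2)]])
  have linear: "linear (\<lambda>c. invariant_extension ?G (E c) x)"
    if "\<And>xs. linear (\<lambda>c. E c xs)" for E :: "'b::real_vector \<Rightarrow> _" and x
    using that by (cases x) (simp add: invariant_extension_def linear_iff)
  have group: "(\<exists>\<phi> :: _ \<Rightarrow> real. cohomology_iso (left_invariant_forms ?G ?V) (ext_deriv ?G ?V) 0 \<phi>) \<and>
     (\<exists>\<phi> :: _ \<Rightarrow> real^2. cohomology_iso (left_invariant_forms ?G ?V) (ext_deriv ?G ?V) 1 \<phi>) \<and>
     (\<exists>\<phi> :: _ \<Rightarrow> real^2. cohomology_iso (left_invariant_forms ?G ?V) (ext_deriv ?G ?V) 2 \<phi>) \<and>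
     (\<exists>\<phi> :: _ \<Rightarrow> real. cohomology_iso (left_invariant_forms ?G ?V) (ext_deriv ?G ?V) 3 \<phi>)"
    by (rule cohomology_of_heisenberg_coordinates[OF
          linear[OF form_linear(1)] linear[OF form_linear(2)] linear[OF form_linear(3)] linear[OF form_linear(4)]
          form_eq_0(1)[OF invariant_extension_eq_0] form_eq_0(2)[OF invariant_extension_eq_0]
          form_eq_0(3)[OF invariant_extension_eq_0] form_eq_0(4)[OF invariant_extension_eq_0]
          left_invariant_forms_eq_range[OF a] heis_ext_deriv[OF a]])
  from algebra group show ?thesis
    by (simp only: conj_assoc)
qed

end
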